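(* Let $A$ be a $\mathbb{Z}$-graded abelian Lie algebra, $\mathcal{Q}$ the quadratic Lie superalgebra and $\mathfrak{g}=A\oplus\mathcal{Q}$. Suppose that $V=\bigoplus_{m\in\mathbb{Z}}V^m$ is a bounded finite weight $\mathbb{Z}$-graded simple $\mathfrak{g}$-module. Then one of the following happens: (i) $t^2\mathbb{C}[t^{\pm4}]$ acts non-trivially on $V$. In this case, there is a finite dimensional simple $\mathfrak{g}$-module $U$ such that $V$ is isomorphic to a simple component of $L(U)$. (ii) $t^2\mathbb{C}[t^{\pm4}]$ acts trivially on $V$. In this case, $t^2\mathbb{C}[t^{\pm4}]\oplus t\mathbb{C}[t^{\pm4}]\oplus t^{-1}\mathbb{C}[t^{\pm4}]$ acts trivially on $V$; in particular, $V$ is a finite weight $\mathbb{Z}$-graded simple module over the abelian $\mathbb{Z}$-graded Lie algebra $A\oplus s^2\mathbb{C}[s^{\pm4}]$.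
   Context: Ground field $\mathbb{C}$. The quadratic Lie superalgebra is $\mathcal{Q}=\mathcal{Q}_0\oplus\mathcal{Q}_1$, $\mathcal{Q}_0=s^2\mathbb{C}[s^{\pm4}]\oplus t^2\mathbb{C}[t^{\pm4}]$, $\mathcal{Q}_1=t\mathbb{C}[t^{\pm4}]\oplus t^{-1}\mathbb{C}[t^{\pm4}]$ (here $s^{4k+2},t^{4k+2},t^{4k\pm1}$, $k\in\mathbb{Z}$, are basis vectors), with the super-antisymmetric bracket determined, for $k,k'\in\mathbb{Z}$, by $[\mathcal{Q}_0,\mathcal{Q}_0]=[t^2\mathbb{C}[t^{\pm4}],\mathcal{Q}_1]=\{0\}$, $[t^{4k+1},t^{4k'-1}]=0$, $[t^{4k+1},t^{4k'+1}]=t^{4(k+k')+2}$, $[t^{4k-1},t^{4k'-1}]=-t^{4(k+k')-2}$, $[s^{4k-2},t^{4k'+1}]=t^{4(k+k')-1}$, $[s^{4k+2},t^{4k'-1}]=t^{4(k+k')+1}$. $\mathfrak{g}=A\oplus\mathcal{Q}$ is the direct sum of Lie superalgebras ($A$ purely even), $\mathbb{Z}$-graded by $\mathfrak{g}^k=A^k\oplus\mathbb{C}s^k\oplus\mathbb{C}t^k$ if $k\in4\mathbb{Z}+2$, $\mathfrak{g}^k=A^k\oplus\mathbb{C}t^k$ if $k\in4\mathbb{Z}\pm1$, $\mathfrak{g}^k=A^k$ if $k\in4\mathbb{Z}$. Modules are $\mathbb{Z}_2$-graded. A $\mathbb{Z}$-graded module is a $\mathbb{Z}$-graded superspace $V$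 with $\mathfrak{g}^kV^m\subseteq V^{k+m}$; it is $\mathbb{Z}$-graded simple if it has no nontrivial $\mathbb{Z}$-graded submodules, finite weight if all $V^m$ are finite dimensional, and a finite weight module is bounded if the dimensions of the $V^m$ are bounded. For a finite dimensional simple $\mathfrak{g}$-module $U$, $L(U)=U\otimes\mathbb{C}[t^{\pm1}]$ is the $\mathbb{Z}$-graded $\mathfrak{g}$-module with action $x(u\otimes t^n)=xu\otimes t^{n+m}$ for $x\in\mathfrak{g}^m$, and $L(U)^n=U\otimes t^n$. A simple component of $L(U)$ means a $\mathbb{Z}$-graded simple submodule of $L(U)$ (when $t^2\mathbb{C}[t^{\pm 4}]$ acts nontrivially on $U$, $L(U)$ is a direct sum of $\mathbb{Z}$-graded simple submodules). *)

theory Defs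
  imports
    Complex_Main
    "HOL-Library.Poly_Mapping"
    "HOL-Library.Product_Plus"
    "HOL-Library.Z2"
begin

section \<open>Graded vector spaces\<close>

text \<open>
  Vector spaces are subspaces \<open>W\<close> of an ambient type that is a complex vector space under \<open>s\<close>;
  \<open>W = UNIV\<close> is allowed. The finitely supported family \<open>d\<close> of homogeneous components is an
  element of \<open>'i \<Rightarrow>\<^sub>0 'v\<close>.
\<close>

definition components_of :: "('i \<Rightarrow> 'v::ab_group_add set) \<Rightarrow> 'v \<Rightarrow> ('i \<Rightarrow>\<^sub>0 'v) \<Rightarrow> bool" where
  "components_of D w d \<longleftrightarrow>
     (\<forall>i. Poly_Mapping.lookup d i \<in> D i) \<and>
     (\<Sum>i\<in>Poly_Mapping.keys d. Poly_Mapping.lookup d i) = w"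

definition components :: "('i \<Rightarrow> 'v::ab_group_add set) \<Rightarrow> 'v \<Rightarrow> 'i \<Rightarrow>\<^sub>0 'v" where
  "components D w = (THE d. components_of D w d)"

definition internal_direct_sum ::
  "(complex \<Rightarrow> 'v::ab_group_add \<Rightarrow> 'v) \<Rightarrow> 'v set \<Rightarrow> ('i \<Rightarrow> 'v set) \<Rightarrow> bool" where
  "internal_direct_sum s W D \<longleftrightarrow>
     module.subspace s W \<and>
     (\<forall>i. module.subspace s (D i) \<and> D i \<subseteq> W) \<and>
     (\<forall>w\<in>W. \<exists>!d. components_of D w d)"

definition finite_dim :: "(complex \<Rightarrow> 'v::ab_group_add \<Rightarrow> 'v) \<Rightarrow> 'v set \<Rightarrow> bool" where
  "finite_dim s W \<longleftrightarrow> (\<exists>B. finite B \<and> B \<subseteq> W \<and> module.span s B = W)"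

definition linear_on ::
  "(complex \<Rightarrow> 'v::ab_group_add \<Rightarrow> 'v) \<Rightarrow> 'v set \<Rightarrow> (complex \<Rightarrow> 'w::ab_group_add \<Rightarrow> 'w) \<Rightarrow> ('v \<Rightarrow> 'w) \<Rightarrow> bool"
  where
  "linear_on s W s' f \<longleftrightarrow>
     (\<forall>x\<in>W. \<forall>y\<in>W. f (x + y) = f x + f y) \<and> (\<forall>c. \<forall>x\<in>W. f (s c x) = s' c (f x))"

definition bilinear_on ::
  "(complex \<Rightarrow> 'u::ab_group_add \<Rightarrow> 'u) \<Rightarrow> 'u set \<Rightarrow> (complex \<Rightarrow> 'v::ab_group_add \<Rightarrow> 'v) \<Rightarrow> 'v set \<Rightarrow>
   (complex \<Rightarrow> 'w::ab_group_add \<Rightarrow> 'w) \<Rightarrow> ('u \<Rightarrow> 'v \<Rightarrow> 'w) \<Rightarrow> bool" where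
  "bilinear_on s X s' Y s'' f \<longleftrightarrow>
     (\<forall>x\<in>X. linear_on s' Y s'' (f x)) \<and> (\<forall>y\<in>Y. linear_on s X s'' (\<lambda>x. f x y))"


section \<open>Superspaces, Lie superalgebras and their modules\<close>

text \<open>The \<open>\<int>\<^sub>2\<close>-grading is indexed by the two-element field \<^typ>\<open>bit\<close>.\<close>

record 'v superspace =
  carrier :: "'v set"
  smult :: "complex \<Rightarrow> 'v \<Rightarrow> 'v"
  par :: "bit \<Rightarrow> 'v set"

record 'g graded_lie = "'g superspace" +
  bracket :: "'g \<Rightarrow> 'g \<Rightarrow> 'g"
  ldeg :: "int \<Rightarrow> 'g set"

record ('g, 'v) gmodule = "'v superspace" +
  act :: "'g \<Rightarrow> 'v \<Rightarrow> 'v"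

record ('g, 'v) graded_gmodule = "('g, 'v) gmodule" +
  mdeg :: "int \<Rightarrow> 'v set"

definition superspace :: "('v::ab_group_add, 'm) superspace_scheme \<Rightarrow> bool" where
  "superspace S \<longleftrightarrow> vector_space (smult S) \<and> internal_direct_sum (smult S) (carrier S) (par S)"

definition graded_superspace ::
  "('v::ab_group_add, 'm) superspace_scheme \<Rightarrow> (int \<Rightarrow> 'v set) \<Rightarrow> bool" where
  "graded_superspace S D \<longleftrightarrow>
     superspace S \<and> internal_direct_sum (smult S) (carrier S) D \<and>
     (\<forall>n. internal_direct_sum (smult S) (D n) (\<lambda>i. D n \<inter> par S i))"

definition ksign :: "bit \<Rightarrow> bit \<Rightarrow> complex" where
  "ksign i j = (if i = 1 \<and> j = 1 then -1 else 1)"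

definition lie_superalgebra :: "('g::ab_group_add, 'm) graded_lie_scheme \<Rightarrow> bool" where
  "lie_superalgebra G \<longleftrightarrow>
     superspace G \<and>
     bilinear_on (smult G) (carrier G) (smult G) (carrier G) (smult G) (bracket G) \<and>
     (\<forall>i j. \<forall>x\<in>par G i. \<forall>y\<in>par G j. bracket G x y \<in> par G (i + j)) \<and>
     (\<forall>i j. \<forall>x\<in>par G i. \<forall>y\<in>par G j.
        bracket G x y = - smult G (ksign i j) (bracket G y x)) \<and>
     (\<forall>i j. \<forall>x\<in>par G i. \<forall>y\<in>par G j. \<forall>z\<in>carrier G.
        bracket G x (bracket G y z) =
          bracket G (bracket G x y) z + smult G (ksign i j) (bracket G y (bracket G x z)))"

definition graded_lie_superalgebra :: "('g::ab_group_add, 'm) graded_lie_scheme \<Rightarrow> bool" where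
  "graded_lie_superalgebra G \<longleftrightarrow>
     lie_superalgebra G \<and> graded_superspace G (ldeg G) \<and>
     (\<forall>k l. \<forall>x\<in>ldeg G k. \<forall>y\<in>ldeg G l. bracket G x y \<in> ldeg G (k + l))"

text \<open>Lie algebras are the purely even Lie superalgebras.\<close>

definition graded_abelian_lie_algebra :: "('g::ab_group_add, 'm) graded_lie_scheme \<Rightarrow> bool" where
  "graded_abelian_lie_algebra G \<longleftrightarrow>
     graded_lie_superalgebra G \<and> par G 1 = {0} \<and>
     (\<forall>x\<in>carrier G. \<forall>y\<in>carrier G. bracket G x y = 0)"

definition lie_sum :: "'g graded_lie \<Rightarrow> 'h graded_lie \<Rightarrow> ('g \<times> 'h) graded_lie" where
  "lie_sum G H =
     \<lparr>carrier = carrier G \<times> carrier H,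
      smult = (\<lambda>c (x, y). (smult G c x, smult H c y)),
      par = (\<lambda>i. par G i \<times> par H i),
      bracket = (\<lambda>(x, y) (x', y'). (bracket G x x', bracket H y y')),
      ldeg = (\<lambda>k. ldeg G k \<times> ldeg H k)\<rparr>"

definition lie_restrict :: "'g graded_lie \<Rightarrow> 'g set \<Rightarrow> 'g graded_lie" where
  "lie_restrict G H =
     G\<lparr>carrier := H, par := (\<lambda>i. par G i \<inter> H), ldeg := (\<lambda>k. ldeg G k \<inter> H)\<rparr>"

definition super_module ::
  "('g::ab_group_add, 'k) graded_lie_scheme \<Rightarrow> ('g, 'v::ab_group_add, 'm) gmodule_scheme \<Rightarrow> bool" where
  "super_module G M \<longleftrightarrow>
     superspace M \<and>
     bilinear_on (smult G) (carrier G) (smult M) (carrier M) (smult M) (act M) \<and>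
     (\<forall>i j. \<forall>x\<in>par G i. \<forall>v\<in>par M j. act M x v \<in> par M (i + j)) \<and>
     (\<forall>i j. \<forall>x\<in>par G i. \<forall>y\<in>par G j. \<forall>v\<in>carrier M.
        act M (bracket G x y) v =
          act M x (act M y v) - smult M (ksign i j) (act M y (act M x v)))"

definition graded_module ::
  "('g::ab_group_add, 'k) graded_lie_scheme \<Rightarrow> ('g, 'v::ab_group_add, 'm) graded_gmodule_scheme \<Rightarrow> bool"
  where
  "graded_module G M \<longleftrightarrow>
     super_module G M \<and> graded_superspace M (mdeg M) \<and>
     (\<forall>k m. \<forall>x\<in>ldeg G k. \<forall>v\<in>mdeg M m. act M x v \<in> mdeg M (k + m))"

text \<open>Modules are \<open>\<int>\<^sub>2\<close>-graded, and so are submodules.\<close>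

definition submodule ::
  "('g::ab_group_add, 'k) graded_lie_scheme \<Rightarrow> ('g, 'v::ab_group_add, 'm) gmodule_scheme \<Rightarrow> 'v set \<Rightarrow> bool"
  where
  "submodule G M W \<longleftrightarrow>
     module.subspace (smult M) W \<and> W \<subseteq> carrier M \<and>
     internal_direct_sum (smult M) W (\<lambda>i. par M i \<inter> W) \<and>
     (\<forall>x\<in>carrier G. \<forall>v\<in>W. act M x v \<in> W)"

definition graded_submodule ::
  "('g::ab_group_add, 'k) graded_lie_scheme \<Rightarrow> ('g, 'v::ab_group_add, 'm) graded_gmodule_scheme \<Rightarrow>
   'v set \<Rightarrow> bool" where
  "graded_submodule G M W \<longleftrightarrow>
     submodule G M W \<and> internal_direct_sum (smult M) W (\<lambda>n. mdeg M n \<inter> W)"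

definition simple_module ::
  "('g::ab_group_add, 'k) graded_lie_scheme \<Rightarrow> ('g, 'v::ab_group_add, 'm) gmodule_scheme \<Rightarrow> bool" where
  "simple_module G M \<longleftrightarrow>
     super_module G M \<and> carrier M \<noteq> {0} \<and>
     (\<forall>W. submodule G M W \<longrightarrow> W = {0} \<or> W = carrier M)"

definition graded_simple_module ::
  "('g::ab_group_add, 'k) graded_lie_scheme \<Rightarrow> ('g, 'v::ab_group_add, 'm) graded_gmodule_scheme \<Rightarrow> bool"
  where
  "graded_simple_module G M \<longleftrightarrow>
     graded_module G M \<and> carrier M \<noteq> {0} \<and>
     (\<forall>W. graded_submodule G M W \<longrightarrow> W = {0} \<or> W = carrier M)"

definition finite_weight :: "('g, 'v::ab_group_add, 'm) graded_gmodule_scheme \<Rightarrow> bool" where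
  "finite_weight M \<longleftrightarrow> (\<forall>n. finite_dim (smult M) (mdeg M n))"

definition bounded_finite_weight :: "('g, 'v::ab_group_add, 'm) graded_gmodule_scheme \<Rightarrow> bool" where
  "bounded_finite_weight M \<longleftrightarrow>
     finite_weight M \<and> (\<exists>N. \<forall>n. vector_space.dim (smult M) (mdeg M n) \<le> N)"

definition acts_trivially :: "'g set \<Rightarrow> ('g, 'v::ab_group_add, 'm) gmodule_scheme \<Rightarrow> bool" where
  "acts_trivially X M \<longleftrightarrow> (\<forall>x\<in>X. \<forall>v\<in>carrier M. act M x v = 0)"

definition mod_restrict :: "('g, 'v) graded_gmodule \<Rightarrow> 'v set \<Rightarrow> ('g, 'v) graded_gmodule" where
  "mod_restrict M W =
     M\<lparr>carrier := W, par := (\<lambda>i. par M i \<inter> W), mdeg := (\<lambda>n. mdeg M n \<inter> W)\<rparr>"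

text \<open>Isomorphisms are even and of degree \<open>0\<close>.\<close>

definition graded_module_iso ::
  "('g::ab_group_add, 'k) graded_lie_scheme \<Rightarrow> ('g, 'v::ab_group_add, 'm) graded_gmodule_scheme \<Rightarrow>
   ('g, 'w::ab_group_add, 'n) graded_gmodule_scheme \<Rightarrow> ('v \<Rightarrow> 'w) \<Rightarrow> bool" where
  "graded_module_iso G M N f \<longleftrightarrow>
     bij_betw f (carrier M) (carrier N) \<and>
     linear_on (smult M) (carrier M) (smult N) f \<and>
     (\<forall>i. f ` par M i = par N i) \<and>
     (\<forall>n. f ` mdeg M n = mdeg N n) \<and>
     (\<forall>x\<in>carrier G. \<forall>v\<in>carrier M. f (act M x v) = act N x (f v))"


section \<open>The module \<open>L(U)\<close>\<close>

text \<open>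
  \<open>U \<otimes> \<complex>[t\<^sup>\<plusminus>\<^sup>1]\<close> is modelled by Laurent polynomials with coefficients in \<open>U\<close>: the tensor
  \<open>u \<otimes> t\<^sup>n\<close> is \<open>Poly_Mapping.single n u\<close>. The action of a general \<open>x\<close> is the sum of the actions of
  its homogeneous components.

  Finite dimensional modules \<open>U\<close> whose existence is asserted are sought inside \<open>nat \<Rightarrow>\<^sub>0 complex\<close>,
  which contains a copy of every finite dimensional complex vector space.
\<close>

definition loop_module ::
  "('g::ab_group_add, 'k) graded_lie_scheme \<Rightarrow> ('g, 'u::ab_group_add, 'm) gmodule_scheme \<Rightarrow>
   ('g, int \<Rightarrow>\<^sub>0 'u) graded_gmodule" where
  "loop_module G U =
     \<lparr>carrier = {f. \<forall>n. Poly_Mapping.lookup f n \<in> carrier U},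
      smult = (\<lambda>c. Poly_Mapping.map (smult U c)),
      par = (\<lambda>i. {f. \<forall>n. Poly_Mapping.lookup f n \<in> par U i}),
      act = (\<lambda>x f. let d = components (ldeg G) x in
        \<Sum>m\<in>Poly_Mapping.keys d. \<Sum>n\<in>Poly_Mapping.keys f.
          Poly_Mapping.single (n + m) (act U (Poly_Mapping.lookup d m) (Poly_Mapping.lookup f n))),
      mdeg = (\<lambda>n. Poly_Mapping.single n ` carrier U)\<rparr>"

definition simple_component ::
  "('g::ab_group_add, 'k) graded_lie_scheme \<Rightarrow> ('g, 'v::ab_group_add) graded_gmodule \<Rightarrow> 'v set \<Rightarrow> bool"
  where
  "simple_component G M W \<longleftrightarrow>
     graded_submodule G M W \<and> graded_simple_module G (mod_restrict M W)"


section \<open>The quadratic Lie superalgebra\<close>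

text \<open>
  For \<open>k \<in> \<int>\<close>, the basis vectors \<open>s\<^sup>4\<^sup>k\<^sup>+\<^sup>2\<close>, \<open>t\<^sup>4\<^sup>k\<^sup>+\<^sup>2\<close>, \<open>t\<^sup>4\<^sup>k\<^sup>+\<^sup>1\<close>, \<open>t\<^sup>4\<^sup>k\<^sup>-\<^sup>1\<close> are \<open>S2 k\<close>, \<open>T2 k\<close>,
  \<open>Tp k\<close>, \<open>Tm k\<close> respectively; so \<open>s\<^sup>4\<^sup>k\<^sup>-\<^sup>2\<close> is \<open>S2 (k - 1)\<close>.
\<close>

datatype qbasis = S2 int | T2 int | Tp int | Tm int

type_synonym quad = "qbasis \<Rightarrow>\<^sub>0 complex"

fun qdeg :: "qbasis \<Rightarrow> int" where
  "qdeg (S2 k) = 4 * k + 2"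
| "qdeg (T2 k) = 4 * k + 2"
| "qdeg (Tp k) = 4 * k + 1"
| "qdeg (Tm k) = 4 * k - 1"

fun qpar :: "qbasis \<Rightarrow> bit" where
  "qpar (S2 k) = 0"
| "qpar (T2 k) = 0"
| "qpar (Tp k) = 1"
| "qpar (Tm k) = 1"

fun qbr :: "qbasis \<Rightarrow> qbasis \<Rightarrow> quad" where
  "qbr (Tp k) (Tp l) = Poly_Mapping.single (T2 (k + l)) 1"
| "qbr (Tm k) (Tm l) = Poly_Mapping.single (T2 (k + l - 1)) (-1)"
| "qbr (S2 k) (Tp l) = Poly_Mapping.single (Tm ((k + 1) + l)) 1"
| "qbr (S2 k) (Tm l) = Poly_Mapping.single (Tp (k + l)) 1"
| "qbr (Tp l) (S2 k) = Poly_Mapping.single (Tm ((k + 1) + l)) (-1)"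
| "qbr (Tm l) (S2 k) = Poly_Mapping.single (Tp (k + l)) (-1)"
| "qbr _ _ = 0"

definition qscale :: "complex \<Rightarrow> ('b \<Rightarrow>\<^sub>0 complex) \<Rightarrow> ('b \<Rightarrow>\<^sub>0 complex)" where
  "qscale c = Poly_Mapping.map ((*) c)"

definition qbracket :: "quad \<Rightarrow> quad \<Rightarrow> quad" where
  "qbracket x y =
     (\<Sum>a\<in>Poly_Mapping.keys x. \<Sum>b\<in>Poly_Mapping.keys y.
        qscale (Poly_Mapping.lookup x a * Poly_Mapping.lookup y b) (qbr a b))"

definition qspan :: "'b set \<Rightarrow> ('b \<Rightarrow>\<^sub>0 complex) set" where
  "qspan B = {x. Poly_Mapping.keys x \<subseteq> B}"

definition quadratic :: "quad graded_lie" where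
  "quadratic =
     \<lparr>carrier = UNIV, smult = qscale, par = (\<lambda>i. qspan {b. qpar b = i}),
      bracket = qbracket, ldeg = (\<lambda>k. qspan {b. qdeg b = k})\<rparr>"

text \<open>As subspaces of \<open>\<Q>\<close>: \<open>s\<^sup>2\<complex>[s\<^sup>\<plusminus>\<^sup>4]\<close>, \<open>t\<^sup>2\<complex>[t\<^sup>\<plusminus>\<^sup>4]\<close>, \<open>t\<complex>[t\<^sup>\<plusminus>\<^sup>4]\<close> and \<open>t\<^sup>-\<^sup>1\<complex>[t\<^sup>\<plusminus>\<^sup>4]\<close>.\<close>

abbreviation "S2_space \<equiv> qspan (range S2)"
abbreviation "T2_space \<equiv> qspan (range T2)"
abbreviation "Tp_space \<equiv> qspan (range Tp)"
abbreviation "Tm_space \<equiv> qspan (range Tm)"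

end

theory Submission
  imports Defs "HOL-Library.Multiset"
begin

text \<open>
  Suppose first that \<open>t\<^sup>2\<complex>[t\<^sup>\<plusminus>\<^sup>4]\<close> acts nontrivially. Then some \<open>t\<^sup>4\<^sup>k\<^sup>+\<^sup>2\<close> acts nontrivially; being central, even
  and homogeneous, it acts bijectively on the graded simple module \<open>V\<close>. Write \<open>t2\<close> for this action, whose
  degree \<open>4 * k + 2\<close> is not zero. The image of \<open>t2 - 1\<close> is then a proper \<open>\<int>\<^sub>2\<close>-graded submodule
  (\<open>t2_diff_image_proper\<close>), of finite codimension because all \<open>V\<^sup>n\<close> are finite dimensional
  (\<open>t2_diff_image_cofinite\<close>). Hence it lies in a maximal submodule \<open>N\<close> with finite dimensional
  simple quotient \<open>U = V / N\<close>. Sending \<open>v \<in> V\<^sup>n\<close> to its class tensored with \<open>t\<^sup>n\<close> defines a homomorphism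
  from \<open>V\<close> to \<open>L(U)\<close>, which is injective by graded simplicity (\<open>loop_embedding\<close>).

  Now suppose that \<open>t\<^sup>2\<complex>[t\<^sup>\<plusminus>\<^sup>4]\<close> acts trivially. Then the odd elements \<open>\<theta>\<^sub>n = t\<^sup>n\<close> anticommute on \<open>V\<close>, and
  \<open>s\<^sup>m\<close> acts on products of them as a derivation with \<open>[s\<^sup>m, \<theta>\<^sub>n] = \<theta>\<^sub>m\<^sub>+\<^sub>n\<close>. If \<open>\<theta>\<^sub>n v \<noteq> 0\<close>, then by simplicity
  \<open>v = r \<theta>\<^sub>n v\<close> for some \<open>r\<close> in the associative algebra of operators generated by the action, so
  \<open>v = (r \<theta>\<^sub>n)\<^sup>k v\<close> for all \<open>k\<close>. Moving the odd factors to the left shows that \<open>v\<close> is a sum of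
  vectors \<open>\<theta>\<^sub>i \<dots> \<theta>\<^sub>j w\<close> with \<open>k\<close> odd factors whose degrees are bounded linearly in \<open>k\<close>
  (\<open>generator_act_odd_products\<close>). At least one of these vectors is nonzero, and then the
  \<open>k choose 2\<close> vectors \<open>\<theta>\<^sub>p \<theta>\<^sub>q w\<close> formed from pairs of its factors are linearly independent
  (\<open>choose_two_bound\<close>). They lie in a number of degrees that is linear in \<open>k\<close>, which contradicts the
  boundedness of the dimensions. So the odd part acts trivially (\<open>odd_acts_trivially\<close>), and graded
  simplicity over \<open>A \<oplus> s\<^sup>2\<complex>[s\<^sup>\<plusminus>\<^sup>4]\<close> follows.
\<close>

section \<open>Graded vector spaces\<close>

text \<open>
  The component of degree \<open>i\<close> of \<open>w\<close>. It is meaningful only for \<open>w\<close> in a subspace of which \<open>D\<close>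
  is a grading; elsewhere it is an arbitrary value.
\<close>
definition hcomp :: "('i \<Rightarrow> 'v::ab_group_add set) \<Rightarrow> 'v \<Rightarrow> 'i \<Rightarrow> 'v" where
  "hcomp D w i = Poly_Mapping.lookup (components D w) i"

lemma lookup_sum_single:
  "finite F \<Longrightarrow> Poly_Mapping.lookup (\<Sum>i\<in>F. Poly_Mapping.single i (y i)) j = (if j \<in> F then y j else 0)"
  by (simp add: lookup_sum lookup_single when_def)

text \<open>
  A grading can be recognized from finite families alone: every element is a finite sum of
  homogeneous ones, and a vanishing finite sum of homogeneous elements of distinct degrees has
  vanishing terms.
\<close>
lemma internal_direct_sumI:
  assumes "vector_space s" and "module.subspace s W"
    and "\<And>i. module.subspace s (D i)" and "\<And>i. D i \<subseteq> W"
    and ex: "\<And>w. w \<in> W \<Longrightarrow> \<exists>F y. finite F \<and> (\<forall>i\<in>F. y i \<in> D i) \<and> w = (\<Sum>i\<in>F. y i)"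
    and uniq: "\<And>F y i. finite F \<Longrightarrow> (\<And>i. i \<in> F \<Longrightarrow> y i \<in> D i) \<Longrightarrow> (\<Sum>i\<in>F. y i) = 0 \<Longrightarrow> i \<in> F \<Longrightarrow> y i = 0"
  shows "internal_direct_sum s W D"
proof -
  interpret vector_space s by fact
  have "\<exists>!d. components_of D w d" if w: "w \<in> W" for w
  proof -
    obtain F y where F: "finite F" "\<forall>i\<in>F. y i \<in> D i" "w = (\<Sum>i\<in>F. y i)"
      using ex[OF w] by blast
    define d where "d = (\<Sum>i\<in>F. Poly_Mapping.single i (y i))"
    have d: "Poly_Mapping.lookup d j = (if j \<in> F then y j else 0)" for j
      unfolding d_def by (rule lookup_sum_single[OF F(1)])
    have keys: "Poly_Mapping.keys d \<subseteq> F"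
      by (auto simp: in_keys_iff d split: if_splits)
    have "(\<Sum>i\<in>Poly_Mapping.keys d. Poly_Mapping.lookup d i) = (\<Sum>i\<in>F. Poly_Mapping.lookup d i)"
      by (rule sum.mono_neutral_left) (use F keys in \<open>auto simp: in_keys_iff\<close>)
    also have "\<dots> = w" using F d by simp
    finally have c: "components_of D w d"
      unfolding components_of_def using d F assms(3) subspace_0 by auto
    moreover have "e = d" if e: "components_of D w e" for e
    proof (rule poly_mapping_eqI)
      fix j
      define K where "K = insert j (Poly_Mapping.keys d \<union> Poly_Mapping.keys e)"
      have K: "finite K" by (simp add: K_def)
      have su: "(\<Sum>i\<in>K. Poly_Mapping.lookup p i) = w"
        if "components_of D w p" "Poly_Mapping.keys p \<subseteq> K" for p
      proof -
        have "(\<Sum>i\<in>Poly_Mapping.keys p. Poly_Mapping.lookup p i) = (\<Sum>i\<in>K. Poly_Mapping.lookup p i)"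
          by (rule sum.mono_neutral_left) (use K that in \<open>auto simp: in_keys_iff\<close>)
        then show ?thesis using that by (simp add: components_of_def)
      qed
      have "Poly_Mapping.lookup e j - Poly_Mapping.lookup d j = 0"
      proof (rule uniq[of K])
        show "Poly_Mapping.lookup e i - Poly_Mapping.lookup d i \<in> D i" for i
          using c e assms(3) by (auto simp: components_of_def intro!: subspace_diff)
        show "(\<Sum>i\<in>K. Poly_Mapping.lookup e i - Poly_Mapping.lookup d i) = 0"
          using su[OF c] su[OF e] by (auto simp: sum_subtractf K_def)
      qed (auto simp: K_def)
      then show "Poly_Mapping.lookup e j = Poly_Mapping.lookup d j" by simp
    qed
    ultimately show ?thesis by blast
  qed
  then show ?thesis using assms by (auto simp: internal_direct_sum_def)
qed

lemma linear_on_add: "linear_on s W s' f \<Longrightarrow> x \<in> W \<Longrightarrow> y \<in> W \<Longrightarrow> f (x + y) = f x + f y"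
  and linear_on_scale: "linear_on s W s' f \<Longrightarrow> x \<in> W \<Longrightarrow> f (s c x) = s' c (f x)"
  by (auto simp: linear_on_def)

text \<open>
  Linear maps are only required to be linear on the subspace \<open>W\<close>, so the usual consequences of
  linearity are derived here relative to \<open>W\<close>.
\<close>
locale vector_subspace = vector_space s for s :: "complex \<Rightarrow> 'v::ab_group_add \<Rightarrow> 'v" +
  fixes W :: "'v set"
  assumes W: "subspace W"
begin

lemma linear_on_0:
  assumes "linear_on s W s' f" shows "f 0 = 0"
proof -
  have "f (0 + 0) = f 0 + f 0" by (rule linear_on_add[OF assms]) (simp_all add: W subspace_0)
  then show ?thesis by simp
qed

lemma linear_on_neg:
  assumes "linear_on s W s' f" "x \<in> W" shows "f (- x) = - f x"
proof -
  have "f (x + - x) = f x + f (- x)"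
    by (rule linear_on_add[OF assms(1)]) (simp_all add: W assms subspace_neg)
  then show ?thesis using linear_on_0[OF assms(1)] by (simp add: eq_neg_iff_add_eq_0 add.commute)
qed

lemma linear_on_diff:
  assumes "linear_on s W s' f" "x \<in> W" "y \<in> W" shows "f (x - y) = f x - f y"
  using linear_on_add[OF assms(1,2), of "- y"] linear_on_neg[OF assms(1,3)] assms W subspace_neg
  by simp

lemma linear_on_sum:
  assumes f: "linear_on s W s' f" and "finite F" "\<And>i. i \<in> F \<Longrightarrow> y i \<in> W"
  shows "f (\<Sum>i\<in>F. y i) = (\<Sum>i\<in>F. f (y i))"
  using assms(2,3)
proof (induction F rule: finite_induct)
  case empty then show ?case by (simp add: linear_on_0[OF f])
next
  case (insert i F)
  then show ?case using W by (simp add: linear_on_add[OF f] subspace_sum)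
qed

lemma subspace_image:
  assumes f: "linear_on s W s' f" and "vector_space s'" "subspace X" "X \<subseteq> W"
  shows "module.subspace s' (f ` X)"
proof -
  interpret t: vector_space s' by fact
  show ?thesis
  proof (rule t.subspaceI)
    show "0 \<in> f ` X" using linear_on_0[OF f] subspace_0[OF assms(3)] by force
    show "x + y \<in> f ` X" if "x \<in> f ` X" "y \<in> f ` X" for x y
      using that assms(3,4) by (auto simp: linear_on_add[OF f, symmetric] subset_iff subspace_add)
    show "s' c x \<in> f ` X" if "x \<in> f ` X" for c x
      using that assms(3,4) by (auto simp: linear_on_scale[OF f, symmetric] subset_iff subspace_scale)
  qed
qed

lemma subspace_vimage:
  assumes f: "linear_on s W s' f" and "vector_space s'" "module.subspace s' X"
  shows "subspace {x \<in> W. f x \<in> X}"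
proof -
  interpret t: vector_space s' by fact
  show ?thesis
    using W assms(3) by (intro subspaceI)
      (auto simp: linear_on_0[OF f] linear_on_add[OF f] linear_on_scale[OF f]
        subspace_0 subspace_add subspace_scale t.subspace_0 t.subspace_add t.subspace_scale)
qed

end

text \<open>
  A subspace \<open>W\<close> with a grading \<open>D\<close> by an arbitrary index type; it is used for the
  \<open>\<int>\<close>-gradings and for the \<open>\<int>\<^sub>2\<close>-gradings alike.
\<close>
locale graded_space = vector_space s for s :: "complex \<Rightarrow> 'v::ab_group_add \<Rightarrow> 'v" +
  fixes W :: "'v set" and D :: "'i \<Rightarrow> 'v set"
  assumes direct: "internal_direct_sum s W D"
begin

sublocale vector_subspace s W
  using direct by unfold_locales (simp add: internal_direct_sum_def)

lemma D: "subspace (D i)" "D i \<subseteq> W"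
  using direct by (auto simp: internal_direct_sum_def)

lemma D_W: "x \<in> D i \<Longrightarrow> x \<in> W" using D by auto

lemma components_of_components: "w \<in> W \<Longrightarrow> components_of D w (components D w)"
  unfolding components_def by (rule theI') (use direct in \<open>auto simp: internal_direct_sum_def\<close>)

lemma components_eqI: "w \<in> W \<Longrightarrow> components_of D w d \<Longrightarrow> components D w = d"
  using direct components_of_components by (auto simp: internal_direct_sum_def)

lemma hcomp_in: "w \<in> W \<Longrightarrow> hcomp D w i \<in> D i"
  using components_of_components by (auto simp: components_of_def hcomp_def)

lemma hcomp_W: "w \<in> W \<Longrightarrow> hcomp D w i \<in> W"
  using hcomp_in D by blast

lemma hcomp_sum:
  assumes "w \<in> W" "finite F" "Poly_Mapping.keys (components D w) \<subseteq> F"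
  shows "(\<Sum>i\<in>F. hcomp D w i) = w"
proof -
  have "(\<Sum>i\<in>Poly_Mapping.keys (components D w). hcomp D w i) = (\<Sum>i\<in>F. hcomp D w i)"
    by (rule sum.mono_neutral_left) (use assms in \<open>auto simp: in_keys_iff hcomp_def\<close>)
  then show ?thesis using components_of_components[OF assms(1)] by (simp add: components_of_def hcomp_def)
qed

lemma hcomp_sum_keys: "w \<in> W \<Longrightarrow> (\<Sum>i\<in>Poly_Mapping.keys (components D w). hcomp D w i) = w"
  by (rule hcomp_sum) auto

lemma hcomp_eqI:
  assumes "finite F" "\<And>i. i \<in> F \<Longrightarrow> y i \<in> D i"
  shows "hcomp D (\<Sum>i\<in>F. y i) j = (if j \<in> F then y j else 0)"
proof -
  define d where "d = (\<Sum>i\<in>F. Poly_Mapping.single i (y i))"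
  have d: "Poly_Mapping.lookup d j = (if j \<in> F then y j else 0)" for j
    unfolding d_def by (rule lookup_sum_single[OF assms(1)])
  have keys: "Poly_Mapping.keys d \<subseteq> F"
    by (auto simp: in_keys_iff d split: if_splits)
  have "(\<Sum>i\<in>Poly_Mapping.keys d. Poly_Mapping.lookup d i) = (\<Sum>i\<in>F. Poly_Mapping.lookup d i)"
    by (rule sum.mono_neutral_left) (use assms keys in \<open>auto simp: in_keys_iff\<close>)
  also have "\<dots> = (\<Sum>i\<in>F. y i)" using d by simp
  finally have "components_of D (\<Sum>i\<in>F. y i) d"
    unfolding components_of_def using d assms D subspace_0 by auto
  moreover have "(\<Sum>i\<in>F. y i) \<in> W"
    using assms D by (intro subspace_sum[OF W]) auto
  ultimately have "components D (\<Sum>i\<in>F. y i) = d"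
    using components_eqI by blast
  then show ?thesis by (simp add: hcomp_def d)
qed

lemma hcomp_homogeneous: "w \<in> D i \<Longrightarrow> hcomp D w j = (if j = i then w else 0)"
  using hcomp_eqI[of "{i}" "\<lambda>_. w" j] by simp

lemma hcomp_0 [simp]: "hcomp D 0 j = 0"
  using hcomp_eqI[of "{}"] by simp

lemma hcomp_add:
  assumes "v \<in> W" "w \<in> W"
  shows "hcomp D (v + w) i = hcomp D v i + hcomp D w i"
proof -
  let ?F = "insert i (Poly_Mapping.keys (components D v) \<union> Poly_Mapping.keys (components D w))"
  have "hcomp D (\<Sum>j\<in>?F. hcomp D v j + hcomp D w j) i = hcomp D v i + hcomp D w i"
    by (subst hcomp_eqI) (auto intro: subspace_add D hcomp_in assms)
  moreover have "(\<Sum>j\<in>?F. hcomp D v j + hcomp D w j) = v + w"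
    unfolding sum.distrib by (intro arg_cong2[where f="(+)"] hcomp_sum assms) auto
  ultimately show ?thesis by simp
qed

lemma hcomp_scale:
  assumes "v \<in> W"
  shows "hcomp D (s c v) i = s c (hcomp D v i)"
proof -
  let ?F = "insert i (Poly_Mapping.keys (components D v))"
  have "hcomp D (\<Sum>j\<in>?F. s c (hcomp D v j)) i = s c (hcomp D v i)"
    by (subst hcomp_eqI) (auto intro: subspace_scale D hcomp_in assms)
  moreover have "(\<Sum>j\<in>?F. s c (hcomp D v j)) = s c v"
    unfolding scale_sum_right[symmetric] by (intro arg_cong[where f="s c"] hcomp_sum assms) auto
  ultimately show ?thesis by simp
qed

lemma hcomp_linear: "linear_on s W s (\<lambda>w. hcomp D w i)"
  by (simp add: linear_on_def hcomp_add hcomp_scale)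

text \<open>
  A linear map that carries the degree \<open>i\<close> into the degree \<open>p i\<close>, with \<open>p\<close> injective, commutes with
  taking components.
\<close>
lemma hcomp_map:
  assumes g: "linear_on s W s g" and "\<And>i w. w \<in> D i \<Longrightarrow> g w \<in> D (p i)" and "inj p" and w: "w \<in> W"
  shows "hcomp D (g w) (p i) = g (hcomp D w i)"
proof -
  let ?F = "insert i (Poly_Mapping.keys (components D w))"
  have "g w = g (\<Sum>j\<in>?F. hcomp D w j)" by (subst hcomp_sum) (auto simp: w)
  also have "\<dots> = (\<Sum>j\<in>?F. g (hcomp D w j))"
    by (rule linear_on_sum[OF g]) (auto intro: hcomp_W w)
  also have "\<dots> = (\<Sum>j\<in>p ` ?F. g (hcomp D w (inv p j)))"
    by (subst sum.reindex[OF inj_on_subset[OF \<open>inj p\<close> subset_UNIV]]) (simp add: \<open>inj p\<close>)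
  finally have "hcomp D (g w) (p i) = hcomp D (\<Sum>j\<in>p ` ?F. g (hcomp D w (inv p j))) (p i)" by simp
  also have "\<dots> = g (hcomp D w i)"
  proof (subst hcomp_eqI)
    show "g (hcomp D w (inv p j)) \<in> D j" if "j \<in> p ` ?F" for j
      using that \<open>inj p\<close> assms(2) hcomp_in[OF w] by auto
  qed (use \<open>inj p\<close> in \<open>auto simp: inj_eq\<close>)
  finally show ?thesis .
qed

text \<open>
  A subspace is graded, in the sense of the two lemmas below, exactly when it contains the
  components of its elements.
\<close>
lemma direct_subI:
  assumes "subspace X" "X \<subseteq> W" "\<And>w i. w \<in> X \<Longrightarrow> hcomp D w i \<in> X"
  shows "internal_direct_sum s X (\<lambda>i. D i \<inter> X)"
proof (rule internal_direct_sumI)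
  show "vector_space s" by unfold_locales
  show "subspace X" by fact
  show "subspace (D i \<inter> X)" for i using D assms by (simp add: subspace_inter)
  show "D i \<inter> X \<subseteq> X" for i by auto
  show "\<exists>F y. finite F \<and> (\<forall>i\<in>F. y i \<in> D i \<inter> X) \<and> w = (\<Sum>i\<in>F. y i)" if "w \<in> X" for w
    using that assms(2,3) hcomp_in hcomp_sum_keys[of w]
    by (intro exI[of _ "Poly_Mapping.keys (components D w)"] exI[of _ "hcomp D w"]) auto
  show "y i = 0" if "finite F" "\<And>i. i \<in> F \<Longrightarrow> y i \<in> D i \<inter> X" "(\<Sum>i\<in>F. y i) = 0" "i \<in> F" for F y i
    using hcomp_eqI[of F y i] that by auto
qed

lemma direct_subD:
  assumes "internal_direct_sum s X (\<lambda>i. D i \<inter> X)" "w \<in> X"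
  shows "hcomp D w i \<in> X"
proof -
  interpret x: graded_space s X "\<lambda>i. D i \<inter> X" by unfold_locales fact
  let ?d = "components (\<lambda>i. D i \<inter> X) w"
  have "hcomp D (\<Sum>j\<in>Poly_Mapping.keys ?d. hcomp (\<lambda>i. D i \<inter> X) w j) i \<in> X"
    by (subst hcomp_eqI) (use x.hcomp_in assms in \<open>auto intro: subspace_0 x.W\<close>)
  then show ?thesis using x.hcomp_sum_keys assms by simp
qed

lemma span_hcomp:
  assumes "S \<subseteq> (\<Union>i. D i)" "w \<in> span S"
  shows "hcomp D w i \<in> span S"
proof -
  have SW: "span S \<subseteq> W" using assms D by (intro span_minimal W) auto
  have "subspace {w \<in> W. hcomp D w i \<in> span S}"
    by (rule subspace_vimage[OF hcomp_linear]) (auto intro: vector_space_axioms)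
  then have "span S \<subseteq> {w \<in> W. hcomp D w i \<in> span S}"
  proof (rule span_minimal[rotated], intro subsetI)
    fix x assume "x \<in> S"
    then obtain j where "x \<in> D j" using assms by auto
    then show "x \<in> {w \<in> W. hcomp D w i \<in> span S}"
      using \<open>x \<in> S\<close> by (auto simp: hcomp_homogeneous D_W span_base span_zero)
  qed
  then show ?thesis using assms by auto
qed

text \<open>
  If the kernel of \<open>f\<close> is graded, then the image of \<open>f\<close> inherits the grading.
\<close>
lemma direct_image:
  assumes f: "linear_on s W s' f" and s': "vector_space s'"
    and ker: "\<And>w i. w \<in> W \<Longrightarrow> f w = 0 \<Longrightarrow> f (hcomp D w i) = 0"
  shows "internal_direct_sum s' (f ` W) (\<lambda>i. f ` D i)"
proof (rule internal_direct_sumI)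
  show "vector_space s'" by fact
  show "module.subspace s' (f ` W)" by (rule subspace_image[OF f s' W]) simp
  show "module.subspace s' (f ` D i)" for i by (rule subspace_image[OF f s' D])
  show "f ` D i \<subseteq> f ` W" for i using D by auto
  show "\<exists>F y. finite F \<and> (\<forall>i\<in>F. y i \<in> f ` D i) \<and> w = (\<Sum>i\<in>F. y i)" if wfW: "w \<in> f ` W" for w
  proof -
    obtain v where v: "v \<in> W" "w = f v" using wfW by auto
    let ?F = "Poly_Mapping.keys (components D v)"
    have "w = (\<Sum>i\<in>?F. f (hcomp D v i))"
      using linear_on_sum[OF f, of ?F "hcomp D v"] hcomp_sum_keys hcomp_W v by simp
    then show ?thesis using hcomp_in[OF v(1)]
      by (intro exI[of _ ?F] exI[of _ "\<lambda>i. f (hcomp D v i)"]) auto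
  qed
  show "y i = 0" if F: "finite F" and y: "\<And>i. i \<in> F \<Longrightarrow> y i \<in> f ` D i" and sum: "(\<Sum>i\<in>F. y i) = 0"
    and i: "i \<in> F" for F y i
  proof -
    have "\<forall>i\<in>F. \<exists>v. v \<in> D i \<and> y i = f v" using y by blast
    then obtain u where u: "\<And>i. i \<in> F \<Longrightarrow> u i \<in> D i \<and> y i = f (u i)"
      unfolding bchoice_iff by blast
    have uW: "u i \<in> W" if "i \<in> F" for i using u[OF that] D by blast
    have "f (\<Sum>i\<in>F. u i) = 0"
    proof -
      have "(\<Sum>i\<in>F. f (u i)) = (\<Sum>i\<in>F. y i)" using u by (intro sum.cong) auto
      then show ?thesis using linear_on_sum[OF f F uW] sum by simp
    qed
    then have "f (hcomp D (\<Sum>i\<in>F. u i) i) = 0"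
      by (intro ker subspace_sum[OF W]) (auto simp: uW)
    then show ?thesis using hcomp_eqI[OF F, of u i] u i by simp
  qed
qed

end

section \<open>The Lie superalgebra \<open>A \<oplus> \<Q>\<close>\<close>

lemma bit_cases: "(i::bit) = 0 \<or> i = 1" by (cases i) auto

lemma lookup_qscale [simp]: "Poly_Mapping.lookup (qscale c x) b = c * Poly_Mapping.lookup x b"
  by (simp add: qscale_def map.rep_eq when_def)

lemma qscale_0 [simp]: "qscale c 0 = 0"
  by (rule poly_mapping_eqI) simp

lemma vector_space_qscale: "vector_space qscale"
  by unfold_locales (auto intro!: poly_mapping_eqI simp: lookup_add algebra_simps)

lemma qspan_iff: "x \<in> qspan B \<longleftrightarrow> (\<forall>b. b \<notin> B \<longrightarrow> Poly_Mapping.lookup x b = 0)"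
  by (auto simp: qspan_def subset_iff in_keys_iff)

lemma subspace_qspan: "module.subspace qscale (qspan B)"
proof -
  interpret vector_space qscale by (rule vector_space_qscale)
  show ?thesis
    by (rule subspaceI) (auto simp: qspan_iff lookup_add)
qed

lemma direct_qspan: "internal_direct_sum qscale (qspan B) (\<lambda>k. qspan {b \<in> B. d b = k})"
proof (rule internal_direct_sumI[OF vector_space_qscale subspace_qspan subspace_qspan])
  show "qspan {b \<in> B. d b = i} \<subseteq> qspan B" for i by (auto simp: qspan_def)
  fix w assume w: "w \<in> qspan B"
  define y where "y k = (\<Sum>b\<in>{b\<in>Poly_Mapping.keys w. d b = k}.
    Poly_Mapping.single b (Poly_Mapping.lookup w b))" for k
  have y: "Poly_Mapping.lookup (y k) b = (if d b = k then Poly_Mapping.lookup w b else 0)" for k b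
    by (auto simp: y_def lookup_sum_single in_keys_iff)
  show "\<exists>F y. finite F \<and> (\<forall>k\<in>F. y k \<in> qspan {b \<in> B. d b = k}) \<and> w = (\<Sum>k\<in>F. y k)"
  proof (intro exI[of _ "d ` Poly_Mapping.keys w"] exI[of _ y] conjI ballI)
    show "y k \<in> qspan {b \<in> B. d b = k}" for k
      using w by (auto simp: qspan_def in_keys_iff y split: if_splits)
    show "w = (\<Sum>k\<in>d ` Poly_Mapping.keys w. y k)"
      by (rule poly_mapping_eqI) (auto simp: lookup_sum y in_keys_iff)
  qed simp
next
  fix F :: "'b set" and y i
  assume F: "finite F" and y: "\<And>i. i \<in> F \<Longrightarrow> y i \<in> qspan {b \<in> B. d b = i}" and sum: "(\<Sum>i\<in>F. y i) = 0"
    and i: "i \<in> F"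
  show "y i = 0"
  proof (rule poly_mapping_eqI)
    fix b
    have ne: "Poly_Mapping.lookup (y j) b = 0" if "j \<in> F" "d b \<noteq> j" for j
      using y[OF that(1)] that(2) by (auto simp: qspan_def in_keys_iff subset_iff)
    have "Poly_Mapping.lookup (y i) b = (\<Sum>j\<in>F. Poly_Mapping.lookup (y j) b)" if "d b = i"
      using F i ne that by (subst sum.remove[of _ i]) (auto intro!: sum.neutral)
    also have "\<dots> = 0" by (simp add: lookup_sum[symmetric] sum)
    finally show "Poly_Mapping.lookup (y i) b = Poly_Mapping.lookup 0 b"
      using ne[OF i] by auto
  qed
qed

lemma vector_space_prod:
  assumes "vector_space s" "vector_space s'"
  shows "vector_space (\<lambda>c (x, y). (s c x, s' c y))"
proof -
  interpret a: vector_space s by fact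
  interpret b: vector_space s' by fact
  show ?thesis
    by unfold_locales (auto simp: a.scale_right_distrib b.scale_right_distrib
      a.scale_left_distrib b.scale_left_distrib)
qed

lemma direct_prod:
  assumes "vector_space s" "vector_space s'"
    and "internal_direct_sum s X D" "internal_direct_sum s' Y E"
  shows "internal_direct_sum (\<lambda>c (x, y). (s c x, s' c y)) (X \<times> Y) (\<lambda>i. D i \<times> E i)"
proof -
  interpret a: graded_space s X D using assms by (simp add: graded_space_def graded_space_axioms_def)
  interpret b: graded_space s' Y E using assms by (simp add: graded_space_def graded_space_axioms_def)
  interpret p: vector_space "\<lambda>c (x, y). (s c x, s' c y)"
    by (rule vector_space_prod) fact+
  have sub: "p.subspace (P \<times> Q)" if "a.subspace P" "b.subspace Q" for P Q
    using that by (intro p.subspaceI)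
      (auto simp: zero_prod_def a.subspace_0 b.subspace_0 a.subspace_add b.subspace_add
        a.subspace_scale b.subspace_scale)
  show ?thesis
  proof (rule internal_direct_sumI)
    show "vector_space (\<lambda>c (x, y). (s c x, s' c y))" by unfold_locales
    show "p.subspace (X \<times> Y)" "p.subspace (D i \<times> E i)" for i
      by (auto intro!: sub a.W b.W a.D b.D)
    show "D i \<times> E i \<subseteq> X \<times> Y" for i by (intro Sigma_mono a.D b.D)
    fix w assume "w \<in> X \<times> Y"
    then obtain x y where w: "w = (x, y)" "x \<in> X" "y \<in> Y" by auto
    let ?F = "Poly_Mapping.keys (components D x) \<union> Poly_Mapping.keys (components E y)"
    show "\<exists>F y. finite F \<and> (\<forall>i\<in>F. y i \<in> D i \<times> E i) \<and> w = (\<Sum>i\<in>F. y i)"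
    proof (intro exI[of _ ?F] exI[of _ "\<lambda>i. (hcomp D x i, hcomp E y i)"] conjI ballI)
      show "w = (\<Sum>i\<in>?F. (hcomp D x i, hcomp E y i))"
        unfolding sum_prod w(1)
        by (auto simp: w intro!: a.hcomp_sum[symmetric] b.hcomp_sum[symmetric])
    qed (use w a.hcomp_in b.hcomp_in in auto)
  next
    fix F y i
    assume F: "finite F" and y: "\<And>i. i \<in> F \<Longrightarrow> y i \<in> D i \<times> E i" and sum: "(\<Sum>i\<in>F. y i) = 0" and i: "i \<in> F"
    have "hcomp D (\<Sum>i\<in>F. fst (y i)) i = fst (y i)" "hcomp E (\<Sum>i\<in>F. snd (y i)) i = snd (y i)"
      using a.hcomp_eqI[OF F, of "\<lambda>i. fst (y i)" i] b.hcomp_eqI[OF F, of "\<lambda>i. snd (y i)" i] y i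
      by (auto simp: mem_Times_iff)
    moreover have "(\<Sum>i\<in>F. fst (y i)) = 0" "(\<Sum>i\<in>F. snd (y i)) = 0"
      using arg_cong[OF sum, of fst] arg_cong[OF sum, of snd] by (simp_all add: fst_sum snd_sum)
    ultimately show "y i = 0" by (simp add: prod_eq_iff)
  qed
qed

text \<open>
  A purely even space is a superspace.
\<close>
lemma direct_even:
  assumes "vector_space s" "module.subspace s X" "P 0 = X" "P 1 = {0}"
  shows "internal_direct_sum s X (P :: bit \<Rightarrow> _)"
proof -
  interpret vector_space s by fact
  have P: "P i = (if i = 0 then X else {0})" for i using assms bit_cases[of i] by auto
  show ?thesis
  proof (rule internal_direct_sumI)
    show "vector_space s" "subspace X" by fact+
    show "subspace (P i)" for i using assms by (simp add: P)
    show "P i \<subseteq> X" for i using assms subspace_0 by (auto simp: P)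
    show "\<exists>F y. finite F \<and> (\<forall>i\<in>F. y i \<in> P i) \<and> w = (\<Sum>i\<in>F. y i)" if "w \<in> X" for w
      using that by (intro exI[of _ "{0}"] exI[of _ "\<lambda>_. w"]) (auto simp: P)
    fix F y i
    assume F: "finite F" and y: "\<And>i. i \<in> F \<Longrightarrow> y i \<in> P i" and sum: "(\<Sum>i\<in>F. y i) = 0" and i: "i \<in> F"
    have "(\<Sum>i\<in>F. y i) = (if 0 \<in> F then y 0 else 0)"
    proof -
      have "y j = 0" if "j \<in> F" "j \<noteq> 0" for j using y[OF that(1)] that by (simp add: P)
      then have "(\<Sum>i\<in>F. y i) = (\<Sum>i\<in>F. if i = 0 then y 0 else 0)" by (intro sum.cong) auto
      then show ?thesis using F by simp
    qed
    then show "y i = 0" using sum y[OF i] i by (auto simp: P split: if_splits)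
  qed
qed

lemma quadratic_simps [simp]:
  "carrier quadratic = UNIV" "smult quadratic = qscale" "par quadratic i = qspan {b. qpar b = i}"
  "bracket quadratic = qbracket" "ldeg quadratic k = qspan {b. qdeg b = k}"
  by (simp_all add: quadratic_def)

lemma lie_sum_simps [simp]:
  "carrier (lie_sum G H) = carrier G \<times> carrier H"
  "smult (lie_sum G H) = (\<lambda>c (x, y). (smult G c x, smult H c y))"
  "par (lie_sum G H) = (\<lambda>i. par G i \<times> par H i)"
  "bracket (lie_sum G H) (x, y) (x', y') = (bracket G x x', bracket H y y')"
  "ldeg (lie_sum G H) = (\<lambda>k. ldeg G k \<times> ldeg H k)"
  by (simp_all add: lie_sum_def)

lemma qbracket_basis: "qbracket (Poly_Mapping.single a 1) (Poly_Mapping.single b 1) = qbr a b"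
  by (auto simp: qbracket_def intro!: poly_mapping_eqI)

lemma qbr_T2 [simp]: "qbr b (T2 k) = 0" by (cases b) auto

lemma qbracket_0 [simp]: "qbracket 0 y = 0" "qbracket x 0 = 0"
  by (simp_all add: qbracket_def)

lemma qbracket_S2: "x \<in> S2_space \<Longrightarrow> y \<in> S2_space \<Longrightarrow> qbracket x y = 0"
  unfolding qbracket_def qspan_def
  by (intro sum.neutral ballI) (auto dest!: subsetD)

text \<open>
  The basis vector \<open>b\<close> of \<open>\<Q>\<close> as an element of \<open>A \<oplus> \<Q>\<close>.
\<close>
definition basis_vector :: "qbasis \<Rightarrow> 'a::zero \<times> quad" where
  "basis_vector b = (0, Poly_Mapping.single b 1)"

text \<open>
  The homogeneous elements of \<open>A\<close> together with the basis vectors of \<open>\<Q>\<close>. They span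
  \<open>A \<oplus> \<Q>\<close>, and each of them is homogeneous for both gradings.
\<close>
definition generators :: "'a::ab_group_add graded_lie \<Rightarrow> ('a \<times> quad) set" where
  "generators A = {(a, 0) | a k. a \<in> ldeg A k} \<union> range basis_vector"

text \<open>
  The Lie superalgebra \<open>\<gg> = A \<oplus> \<Q>\<close>, here called \<open>G\<close>.
\<close>
locale abelian_plus_quadratic =
  fixes A :: "'a::ab_group_add graded_lie" and G
  assumes A: "graded_abelian_lie_algebra A"
  defines "G \<equiv> lie_sum A quadratic"
begin

lemma A_direct: "internal_direct_sum (smult A) (carrier A) (ldeg A)"
  and A_par_direct: "internal_direct_sum (smult A) (carrier A) (par A)"
  and A_par_1: "par A 1 = {0}"
  and vector_space_A: "vector_space (smult A)"
  and A_bracket [simp]: "x \<in> carrier A \<Longrightarrow> y \<in> carrier A \<Longrightarrow> bracket A x y = 0"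
  using A by (auto simp: graded_abelian_lie_algebra_def graded_lie_superalgebra_def
    graded_superspace_def superspace_def)

sublocale A: graded_space "smult A" "carrier A" "ldeg A"
  using A_direct vector_space_A by (simp add: graded_space_def graded_space_axioms_def)

sublocale Ap: graded_space "smult A" "carrier A" "par A"
  using A_par_direct vector_space_A by (simp add: graded_space_def graded_space_axioms_def)

lemma A_par_0: "par A 0 = carrier A"
proof
  show "carrier A \<subseteq> par A 0"
  proof
    fix x assume x: "x \<in> carrier A"
    have "(\<Sum>i\<in>{0, 1}. hcomp (par A) x i) = x"
      using bit_cases by (intro Ap.hcomp_sum x) auto
    then have "hcomp (par A) x 0 + hcomp (par A) x 1 = x" by simp
    moreover have "hcomp (par A) x 1 = 0" using Ap.hcomp_in[OF x, of 1] A_par_1 by simp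
    ultimately show "x \<in> par A 0" using Ap.hcomp_in[OF x, of 0] by simp
  qed
qed (rule Ap.D)

lemma zero_in_A [simp]: "0 \<in> carrier A" "0 \<in> ldeg A k" "0 \<in> par A i"
  using A.subspace_0 A.W A.D Ap.D by auto

lemma zero_in_G [simp]: "0 \<in> carrier G"
  by (simp add: zero_prod_def G_def)

lemma vector_space_G: "vector_space (smult G)"
  using vector_space_prod[OF vector_space_A vector_space_qscale] by (simp add: G_def)

sublocale G: graded_space "smult G" "carrier G" "ldeg G"
proof -
  have "internal_direct_sum (smult G) (carrier G) (ldeg G)"
    using direct_prod[OF vector_space_A vector_space_qscale A_direct direct_qspan[of UNIV qdeg]]
    by (simp add: G_def qspan_def)
  then show "graded_space (smult G) (carrier G) (ldeg G)"
    using vector_space_G by (simp add: graded_space_def graded_space_axioms_def)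
qed

lemma generators_carrier: "x \<in> generators A \<Longrightarrow> x \<in> carrier G"
  using A.D by (auto simp: generators_def basis_vector_def G_def)

lemma basis_vector_homogeneous: "basis_vector b \<in> ldeg G (qdeg b)" "basis_vector b \<in> par G (qpar b)"
  by (auto simp: basis_vector_def G_def qspan_def)

lemma A_even: "a \<in> carrier A \<Longrightarrow> (a, 0) \<in> par G 0"
  by (simp add: G_def A_par_0 qspan_def)

lemma generators_homogeneous:
  assumes "x \<in> generators A" obtains k i where "x \<in> ldeg G k" "x \<in> par G i"
proof -
  have "\<exists>k i. x \<in> ldeg G k \<and> x \<in> par G i"
  proof -
    consider a k where "x = (a, 0)" "a \<in> ldeg A k" | b where "x = basis_vector b"
      using assms by (auto simp: generators_def)
    then show ?thesis
    proof cases
      case 1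
      then show ?thesis using A_even[OF A.D_W[OF 1(2)]] by (auto simp: G_def qspan_def intro!: exI[of _ k])
    next
      case 2
      then show ?thesis using basis_vector_homogeneous by blast
    qed
  qed
  then show ?thesis using that by blast
qed

lemma generators_cases:
  assumes "x \<in> generators A"
  obtains (abelian) a where "x = (a, 0)" "a \<in> carrier A"
    | (s) k where "x = basis_vector (S2 k)"
    | (t2) k where "x = basis_vector (T2 k)"
    | (odd) b where "x = basis_vector b" "qpar b = 1"
proof -
  have *: "(\<exists>k. b = S2 k) \<or> (\<exists>k. b = T2 k) \<or> qpar b = 1" for b by (cases b) auto
  from assms consider a k where "x = (a, 0)" "a \<in> ldeg A k" | b where "x = basis_vector b"
    by (auto simp: generators_def)
  then show thesis
  proof cases
    case 1 then show thesis by (intro that(1) A.D_W)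
  next
    case 2 then show thesis using *[of b] that(2-4) by blast
  qed
qed

lemma quad_decomp:
  "(0, q) = (\<Sum>b\<in>Poly_Mapping.keys q. smult G (Poly_Mapping.lookup q b) (basis_vector b))"
proof -
  have "q = (\<Sum>b\<in>Poly_Mapping.keys q. Poly_Mapping.single b (Poly_Mapping.lookup q b))"
    by (rule poly_mapping_eqI) (auto simp: lookup_sum_single in_keys_iff)
  moreover have "smult G c (basis_vector b) = (0, Poly_Mapping.single b c)" for c b
    by (auto simp: G_def basis_vector_def A.scale_zero_right lookup_single when_def intro!: poly_mapping_eqI)
  ultimately show ?thesis by (simp add: sum_prod)
qed

lemma carrier_induct [consumes 1, case_names generator zero add scale]:
  assumes x: "x \<in> carrier G"
    and gen: "\<And>x. x \<in> generators A \<Longrightarrow> P x"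
    and zero: "P 0"
    and add: "\<And>x y. x \<in> carrier G \<Longrightarrow> y \<in> carrier G \<Longrightarrow> P x \<Longrightarrow> P y \<Longrightarrow> P (x + y)"
    and scale: "\<And>c x. x \<in> carrier G \<Longrightarrow> P x \<Longrightarrow> P (smult G c x)"
  shows "P x"
proof -
  let ?Q = "\<lambda>x. x \<in> carrier G \<and> P x"
  have sum: "?Q (\<Sum>i\<in>F. y i)" if "finite F" "\<And>i. i \<in> F \<Longrightarrow> ?Q (y i)" for F :: "'i set" and y
    using that
  proof (induction F rule: finite_induct)
    case empty then show ?case by (simp add: zero)
  next
    case (insert i F)
    then show ?case by (auto simp: add G.subspace_add[OF G.W])
  qed
  obtain a q where aq: "x = (a, q)" "a \<in> carrier A" using x by (auto simp: G_def)
  have "(a, 0) = (\<Sum>k\<in>Poly_Mapping.keys (components (ldeg A) a). (hcomp (ldeg A) a k, 0::quad))"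
    unfolding sum_prod by (simp add: A.hcomp_sum_keys aq)
  moreover have "?Q (hcomp (ldeg A) a k, 0)" for k
    using A.hcomp_in[OF aq(2), of k]
    by (auto intro!: gen generators_carrier simp: generators_def)
  ultimately have a: "?Q (a, 0)" using sum by (metis (no_types, lifting) finite_keys)
  have "(0, q) = (\<Sum>b\<in>Poly_Mapping.keys q. smult G (Poly_Mapping.lookup q b) (basis_vector b))"
    by (rule quad_decomp)
  moreover have "?Q (smult G c (basis_vector b))" for c b
    using gen[of "basis_vector b"] generators_carrier[of "basis_vector b"]
    by (auto intro!: scale G.subspace_scale[OF G.W] simp: generators_def)
  ultimately have q: "?Q (0, q)" using sum by (metis (no_types, lifting) finite_keys)
  show ?thesis using add[of "(a, 0)" "(0, q)"] a q aq by simp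
qed

end

section \<open>Graded modules over \<open>A \<oplus> \<Q>\<close>\<close>

locale quadratic_module = abelian_plus_quadratic A G
  for A :: "'a::ab_group_add graded_lie" and G +
  fixes V :: "('a \<times> quad, 'v::ab_group_add) graded_gmodule"
  assumes V: "graded_module G V"
begin

lemma super_module_V: "super_module G V"
  using V by (simp add: graded_module_def)

sublocale deg: graded_space "smult V" "carrier V" "mdeg V"
  using V by (simp add: graded_space_def graded_space_axioms_def graded_module_def
    graded_superspace_def superspace_def)

sublocale par: graded_space "smult V" "carrier V" "par V"
  using V by (simp add: graded_space_def graded_space_axioms_def graded_module_def
    graded_superspace_def superspace_def)

lemma act_linear: "x \<in> carrier G \<Longrightarrow> linear_on (smult V) (carrier V) (smult V) (act V x)"
  and act_linear_left: "v \<in> carrier V \<Longrightarrow> linear_on (smult G) (carrier G) (smult V) (\<lambda>x. act V x v)"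
  and act_par: "x \<in> par G i \<Longrightarrow> v \<in> par V j \<Longrightarrow> act V x v \<in> par V (i + j)"
  and act_bracket: "x \<in> par G i \<Longrightarrow> y \<in> par G j \<Longrightarrow> v \<in> carrier V \<Longrightarrow>
    act V (bracket G x y) v = act V x (act V y v) - smult V (ksign i j) (act V y (act V x v))"
  using super_module_V by (auto simp: super_module_def bilinear_on_def)

lemma act_deg: "x \<in> ldeg G k \<Longrightarrow> v \<in> mdeg V m \<Longrightarrow> act V x v \<in> mdeg V (k + m)"
  using V by (auto simp: graded_module_def)

lemmas act_add = linear_on_add[OF act_linear]
  and act_scale = linear_on_scale[OF act_linear]
  and act_diff = deg.linear_on_diff[OF act_linear]
  and act_sum = deg.linear_on_sum[OF act_linear]
  and act_0 [simp] = deg.linear_on_0[OF act_linear]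
  and act_add_left = linear_on_add[OF act_linear_left]
  and act_scale_left = linear_on_scale[OF act_linear_left]
  and act_sum_left = G.linear_on_sum[OF act_linear_left]
  and act_0_left [simp] = G.linear_on_0[OF act_linear_left]

lemma par_decomp: "v \<in> carrier V \<Longrightarrow> hcomp (par V) v 0 + hcomp (par V) v 1 = v"
  using par.hcomp_sum[of v "{0, 1}"] bit_cases by auto

lemma subspace_act_induct:
  assumes X: "deg.subspace X" and v: "v \<in> carrier V"
    and gen: "\<And>x. x \<in> generators A \<Longrightarrow> act V x v \<in> X" and x: "x \<in> carrier G"
  shows "act V x v \<in> X"
  using x
proof (induction x rule: carrier_induct)
  case (add x y) then show ?case using X v by (simp add: act_add_left deg.subspace_add)
next
  case (scale c x) then show ?case using X v by (simp add: act_scale_left deg.subspace_scale)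
next
  case zero then show ?case using X v by (simp add: deg.subspace_0)
qed (simp add: gen)

lemma act_closed:
  assumes x: "x \<in> carrier G" and v: "v \<in> carrier V"
  shows "act V x v \<in> carrier V"
proof (rule subspace_act_induct[OF deg.W v _ x])
  fix x assume g: "x \<in> generators A"
  then obtain i where i: "x \<in> par G i" using generators_homogeneous by blast
  have "act V x v = act V x (hcomp (par V) v 0) + act V x (hcomp (par V) v 1)"
    using par_decomp[OF v] act_add[OF generators_carrier[OF g]] par.hcomp_W[OF v] by metis
  then show "act V x v \<in> carrier V"
    using act_par[OF i par.hcomp_in[OF v]] par.D_W by (metis deg.W deg.subspace_add)
qed

text \<open>
  The two gradings of \<open>V\<close> are compatible: taking components for one of them preserves the
  homogeneous subspaces of the other.
\<close>
lemma par_hcomp_mdeg: "v \<in> mdeg V n \<Longrightarrow> hcomp (par V) v i \<in> mdeg V n"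
  by (rule par.direct_subD)
    (use V in \<open>simp_all add: graded_module_def graded_superspace_def Int_commute\<close>)

lemma hcomp_commute:
  assumes "v \<in> carrier V"
  shows "hcomp (mdeg V) (hcomp (par V) v i) n = hcomp (par V) (hcomp (mdeg V) v n) i"
  using deg.hcomp_map[where g = "\<lambda>w. hcomp (par V) w i" and p = id and w = v and i = n, OF par.hcomp_linear] assms by (simp add: par_hcomp_mdeg)

lemma mdeg_hcomp_par: "v \<in> par V i \<Longrightarrow> hcomp (mdeg V) v n \<in> par V i"
  using hcomp_commute[of v i n] par.hcomp_in[OF deg.hcomp_W, of v n i] par.D_W[of v i]
  by (simp add: par.hcomp_homogeneous)

lemma hcomp_act_deg:
  assumes "x \<in> ldeg G k" "v \<in> carrier V"
  shows "hcomp (mdeg V) (act V x v) n = act V x (hcomp (mdeg V) v (n - k))"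
  using deg.hcomp_map[OF act_linear[OF G.D_W[OF assms(1)]] act_deg[OF assms(1)] inj_on_add assms(2), of "n - k"]
  by simp

lemma hcomp_act_par:
  assumes "x \<in> carrier G" "x \<in> par G j" "v \<in> carrier V"
  shows "hcomp (par V) (act V x v) i = act V x (hcomp (par V) v (i - j))"
  using par.hcomp_map[OF act_linear[OF assms(1)] act_par[OF assms(2)] inj_on_add assms(3), of "i - j"]
  by (simp only: add.commute[of j] diff_add_cancel)

text \<open>
  The vectors that are homogeneous both for the \<open>\<int>\<close>-grading and for the \<open>\<int>\<^sub>2\<close>-grading.
\<close>
definition homogeneous :: "'v set" where
  "homogeneous = (\<Union>n i. mdeg V n \<inter> par V i)"

lemma homogeneousI: "v \<in> mdeg V n \<Longrightarrow> v \<in> par V i \<Longrightarrow> v \<in> homogeneous"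
  and homogeneousE: "v \<in> homogeneous \<Longrightarrow> (\<And>n i. v \<in> mdeg V n \<Longrightarrow> v \<in> par V i \<Longrightarrow> thesis) \<Longrightarrow> thesis"
  by (auto simp: homogeneous_def)

lemma homogeneous_carrier: "homogeneous \<subseteq> carrier V"
  using deg.D by (auto simp: homogeneous_def)

lemma span_homogeneous: "deg.span homogeneous = carrier V"
proof
  show "deg.span homogeneous \<subseteq> carrier V"
    by (rule deg.span_minimal[OF homogeneous_carrier deg.W])
  show "carrier V \<subseteq> deg.span homogeneous"
  proof
    fix v assume v: "v \<in> carrier V"
    have "hcomp (par V) (hcomp (mdeg V) v n) i \<in> homogeneous" for n i
      by (rule homogeneousI[OF par_hcomp_mdeg[OF deg.hcomp_in[OF v]] par.hcomp_in[OF deg.hcomp_W[OF v]]])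
    then have "hcomp (mdeg V) v n \<in> deg.span homogeneous" for n
      using par_decomp[OF deg.hcomp_W[OF v], of n] deg.span_add deg.span_base by metis
    then have "(\<Sum>n\<in>Poly_Mapping.keys (components (mdeg V) v). hcomp (mdeg V) v n) \<in> deg.span homogeneous"
      by (intro deg.span_sum)
    then show "v \<in> deg.span homogeneous" using deg.hcomp_sum_keys v by simp
  qed
qed

lemma homogeneous_act: "x \<in> generators A \<Longrightarrow> v \<in> homogeneous \<Longrightarrow> act V x v \<in> homogeneous"
  by (elim homogeneousE generators_homogeneous) (rule homogeneousI[OF act_deg act_par])

lemma submoduleI:
  assumes "deg.subspace X" "X \<subseteq> carrier V"
    and "\<And>v i. v \<in> X \<Longrightarrow> hcomp (par V) v i \<in> X"
    and "\<And>x v. x \<in> generators A \<Longrightarrow> v \<in> X \<Longrightarrow> act V x v \<in> X"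
  shows "submodule G V X"
  unfolding submodule_def
proof (intro conjI ballI)
  show "internal_direct_sum (smult V) X (\<lambda>i. par V i \<inter> X)"
    by (rule par.direct_subI) fact+
  show "act V x v \<in> X" if "x \<in> carrier G" "v \<in> X" for x v
    by (rule subspace_act_induct[OF assms(1) subsetD[OF assms(2) that(2)] assms(4) that(1)])
      (simp_all add: that)
qed fact+

lemma submoduleD:
  assumes "submodule G V X"
  shows "deg.subspace X" "X \<subseteq> carrier V" "v \<in> X \<Longrightarrow> hcomp (par V) v i \<in> X"
    and "x \<in> carrier G \<Longrightarrow> v \<in> X \<Longrightarrow> act V x v \<in> X"
  using assms par.direct_subD[of X v i] by (auto simp: submodule_def)

lemma graded_submoduleI:
  assumes "deg.subspace X" "X \<subseteq> carrier V"
    and "\<And>v i. v \<in> X \<Longrightarrow> hcomp (par V) v i \<in> X"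
    and "\<And>v n. v \<in> X \<Longrightarrow> hcomp (mdeg V) v n \<in> X"
    and "\<And>x v. x \<in> generators A \<Longrightarrow> v \<in> X \<Longrightarrow> act V x v \<in> X"
  shows "graded_submodule G V X"
  unfolding graded_submodule_def
proof
  show "submodule G V X" by (rule submoduleI) fact+
  show "internal_direct_sum (smult V) X (\<lambda>n. mdeg V n \<inter> X)"
    by (rule deg.direct_subI) fact+
qed

lemma basis_vector_carrier [simp]: "basis_vector b \<in> carrier G"
  by (rule generators_carrier) (simp add: generators_def)

lemma quad_act_0:
  assumes "\<And>b. b \<in> Poly_Mapping.keys q \<Longrightarrow> act V (basis_vector b) v = 0" "v \<in> carrier V"
  shows "act V (0, q) v = 0"
proof -
  have "act V (0, q) v = (\<Sum>b\<in>Poly_Mapping.keys q. act V (smult G (Poly_Mapping.lookup q b) (basis_vector b)) v)"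
    unfolding quad_decomp[of q]
    by (intro act_sum_left) (auto simp: assms intro: G.subspace_scale[OF G.W])
  also have "\<dots> = 0"
    by (rule sum.neutral) (simp add: act_scale_left assms)
  finally show ?thesis .
qed

lemma qbr_act:
  assumes "v \<in> carrier V"
  shows "act V (0, qbr a b) v = act V (basis_vector a) (act V (basis_vector b) v)
    - smult V (ksign (qpar a) (qpar b)) (act V (basis_vector b) (act V (basis_vector a) v))"
  using act_bracket[OF basis_vector_homogeneous(2) basis_vector_homogeneous(2) assms, of a b]
  by (simp add: basis_vector_def G_def qbracket_basis)

lemma A_act_commute:
  assumes "a \<in> carrier A" "v \<in> carrier V"
  shows "act V (a, 0) (act V (basis_vector b) v) = act V (basis_vector b) (act V (a, 0) v)"
  using act_bracket[OF A_even[OF assms(1)] basis_vector_homogeneous(2) assms(2), of b] assms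
  by (simp add: basis_vector_def G_def ksign_def act_0_left[unfolded G_def zero_prod_def])

lemma T2_act_commute:
  assumes x: "x \<in> carrier G" and v: "v \<in> carrier V"
  shows "act V x (act V (basis_vector (T2 k)) v) = act V (basis_vector (T2 k)) (act V x v)"
  using x
proof (induction x rule: carrier_induct)
  case (generator x)
  then consider a where "x = (a, 0)" "a \<in> carrier A" | b where "x = basis_vector b"
    by (auto simp: generators_def dest: A.D_W)
  then show ?case
  proof cases
    case 1 then show ?thesis using A_act_commute v by simp
  next
    case 2 then show ?thesis
      using qbr_act[OF v, of b "T2 k"] v by (simp add: ksign_def zero_prod_def[symmetric])
  qed
next
  case zero then show ?case using v by (simp add: act_closed)
next
  case (add x y) then show ?case using v by (simp add: act_closed act_add_left act_add)
next
  case (scale c x) then show ?case using v by (simp add: act_closed act_scale_left act_scale)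
qed

end

section \<open>Triviality of the odd part\<close>

text \<open>
  Vectors are linearly independent if for each of them some linear map annihilates all the
  others but not the vector itself.
\<close>
lemma (in vector_subspace) independent_by_separation:
  assumes "finite P" "\<And>i. i \<in> P \<Longrightarrow> f i \<in> W" and g: "\<And>i. i \<in> P \<Longrightarrow> linear_on s W s (g i)"
    and sep: "\<And>i j. i \<in> P \<Longrightarrow> j \<in> P \<Longrightarrow> g i (f j) = 0 \<longleftrightarrow> i \<noteq> j"
  shows "inj_on f P" "independent (f ` P)"
proof -
  show inj: "inj_on f P"
    by (rule inj_onI) (metis sep)
  have "u (f i) = 0" if sum: "(\<Sum>v\<in>f ` P. s (u v) v) = 0" and i: "i \<in> P" for u i
  proof -
    have "(\<Sum>j\<in>P. s (u (f j)) (f j)) = 0"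
      using sum by (simp add: sum.reindex[OF inj])
    then have "0 = g i (\<Sum>j\<in>P. s (u (f j)) (f j))"
      using linear_on_0[OF g[OF i]] by simp
    also have "\<dots> = (\<Sum>j\<in>P. g i (s (u (f j)) (f j)))"
      using assms(1,2) W by (intro linear_on_sum[OF g[OF i]]) (auto intro: subspace_scale)
    also have "\<dots> = (\<Sum>j\<in>P. if j = i then s (u (f i)) (g i (f i)) else 0)"
      using i by (intro sum.cong) (auto simp: linear_on_scale[OF g] assms(2) sep)
    also have "\<dots> = s (u (f i)) (g i (f i))" using assms(1) i by simp
    finally show ?thesis using sep[OF i i] by simp
  qed
  then show "independent (f ` P)"
    using assms(1) by (auto simp: dependent_finite)
qed

text \<open>
  The bracket with \<open>s\<^sup>m\<close>, \<open>m = 4 * k + 2\<close>, raises the exponent of an odd basis vector by \<open>m\<close>; on the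
  even basis vectors the value of this function is irrelevant.
\<close>
fun qshift :: "int \<Rightarrow> qbasis \<Rightarrow> qbasis" where
  "qshift k (Tp l) = Tm (k + 1 + l)"
| "qshift k (Tm l) = Tp (k + l)"
| "qshift k b = b"

lemma qshift:
  assumes "qpar b = 1"
  shows "qbr (S2 k) b = Poly_Mapping.single (qshift k b) 1" "qpar (qshift k b) = 1"
    and "qdeg (qshift k b) = qdeg b + (4 * k + 2)"
  using assms by (cases b; simp)+

lemma qbr_odd: "qpar a = 1 \<Longrightarrow> qpar b = 1 \<Longrightarrow> qbr a b \<in> T2_space"
  by (cases a; cases b) (auto simp: qspan_def)

context quadratic_module
begin

lemma act_span:
  assumes x: "x \<in> carrier G" and S: "S \<subseteq> carrier V" and T: "\<And>p. p \<in> S \<Longrightarrow> act V x p \<in> deg.span T"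
    and v: "v \<in> deg.span S"
  shows "act V x v \<in> deg.span T"
proof -
  have "deg.subspace {v \<in> carrier V. act V x v \<in> deg.span T}"
    by (rule deg.subspace_vimage[OF act_linear]) (auto intro: deg.vector_space_axioms x)
  then have "deg.span S \<subseteq> {v \<in> carrier V. act V x v \<in> deg.span T}"
    by (rule deg.span_minimal[rotated]) (use S T in auto)
  then show ?thesis using v by auto
qed

text \<open>
  The vector obtained from \<open>v\<close> by applying the basis vectors in the list \<open>bs\<close>, the last one first.
\<close>
definition basis_product :: "qbasis list \<Rightarrow> 'v \<Rightarrow> 'v" where
  "basis_product bs v = foldr (\<lambda>b. act V (basis_vector b)) bs v"

lemma basis_product_simps [simp]:
  "basis_product [] v = v"
  "basis_product (b # bs) v = act V (basis_vector b) (basis_product bs v)"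
  "basis_product (bs @ cs) v = basis_product bs (basis_product cs v)"
  by (simp_all add: basis_product_def)

lemma basis_product_closed [simp]: "v \<in> carrier V \<Longrightarrow> basis_product bs v \<in> carrier V"
  by (induction bs) (auto simp: act_closed)

lemma basis_product_homogeneous: "v \<in> homogeneous \<Longrightarrow> basis_product bs v \<in> homogeneous"
  by (induction bs) (auto simp: homogeneous_act generators_def)

lemma basis_product_linear: "linear_on (smult V) (carrier V) (smult V) (basis_product bs)"
  by (induction bs) (auto simp: linear_on_def act_add act_scale)

lemma basis_product_deg:
  "v \<in> mdeg V n \<Longrightarrow> basis_product bs v \<in> mdeg V (sum_list (map qdeg bs) + n)"
proof (induction bs)
  case (Cons b bs)
  then show ?case
    using act_deg[OF basis_vector_homogeneous(1), of "basis_product bs v" _ b] by (simp add: add.assoc)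
qed simp

lemma A_act_basis_product:
  assumes "a \<in> carrier A" "v \<in> carrier V"
  shows "act V (a, 0) (basis_product bs v) = basis_product bs (act V (a, 0) v)"
  by (induction bs) (simp_all add: assms A_act_commute)

end

text \<open>
  Modules on which \<open>t\<^sup>2\<complex>[t\<^sup>\<plusminus>\<^sup>4]\<close> acts as zero. On such a module the odd elements of \<open>\<Q>\<close> anticommute,
  because their brackets lie in \<open>t\<^sup>2\<complex>[t\<^sup>\<plusminus>\<^sup>4]\<close>.
\<close>
locale T2_trivial_module = quadratic_module A G V
  for A :: "'a::ab_group_add graded_lie" and G and V :: "('a \<times> quad, 'v::ab_group_add) graded_gmodule" +
  assumes T2_trivial: "q \<in> T2_space \<Longrightarrow> v \<in> carrier V \<Longrightarrow> act V (0, q) v = 0"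
begin

lemma T2_act_0: "v \<in> carrier V \<Longrightarrow> act V (basis_vector (T2 k)) v = 0"
  using T2_trivial[of "Poly_Mapping.single (T2 k) 1" v] by (simp add: basis_vector_def qspan_def)

lemma odd_anticommute:
  assumes "qpar a = 1" "qpar b = 1" "v \<in> carrier V"
  shows "act V (basis_vector a) (act V (basis_vector b) v) = - act V (basis_vector b) (act V (basis_vector a) v)"
  using qbr_act[OF assms(3), of a b] T2_trivial[OF qbr_odd[OF assms(1,2)] assms(3)] assms
  by (simp add: ksign_def deg.scale_minus_left eq_neg_iff_add_eq_0)

lemma odd_square:
  assumes "qpar b = 1" "v \<in> carrier V"
  shows "act V (basis_vector b) (act V (basis_vector b) v) = 0" (is "?x = 0")
proof -
  have "?x + ?x = 0" using odd_anticommute[OF assms(1) assms] by (simp add: eq_neg_iff_add_eq_0)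
  then have "smult V 2 ?x = 0" using deg.scale_left_distrib[of 1 1 ?x] by simp
  then show ?thesis by (simp add: deg.scale_eq_0_iff)
qed

lemma odd_act_basis_product:
  assumes "qpar b = 1" "\<forall>c\<in>set bs. qpar c = 1" "v \<in> carrier V"
  shows "act V (basis_vector b) (basis_product bs v)
    = smult V ((- 1) ^ length bs) (basis_product bs (act V (basis_vector b) v))"
  using assms(2)
proof (induction bs)
  case (Cons c bs)
  then show ?case
    using assms by (simp add: odd_anticommute[of b c] act_scale act_closed deg.scale_minus_left)
qed simp

lemma basis_product_remove1:
  assumes "\<forall>c\<in>set bs. qpar c = 1" "v \<in> carrier V" "b \<in> set bs"
  shows "\<exists>c. c \<noteq> 0 \<and> basis_product bs v = smult V c (act V (basis_vector b) (basis_product (remove1 b bs) v))"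
  using assms(1,3)
proof (induction bs)
  case (Cons a bs)
  show ?case
  proof (cases "a = b")
    case True then show ?thesis by (intro exI[of _ 1]) simp
  next
    case False
    then obtain c where c: "c \<noteq> 0"
      "basis_product bs v = smult V c (act V (basis_vector b) (basis_product (remove1 b bs) v))"
      using Cons by auto
    then show ?thesis
      using Cons.prems False assms(2)
      by (intro exI[of _ "- c"])
        (auto simp: act_scale act_closed odd_anticommute[of a b] deg.scale_minus_left)
  qed
qed simp

lemma basis_product_perm:
  assumes "mset xs = mset ys" "\<forall>c\<in>set xs. qpar c = 1" "v \<in> carrier V"
  shows "\<exists>c. c \<noteq> 0 \<and> basis_product ys v = smult V c (basis_product xs v)"
  using assms(1,2)
proof (induction xs arbitrary: ys)
  case Nil then show ?case by (intro exI[of _ 1]) (simp add: eq_commute[of "{#}"])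
next
  case (Cons x xs)
  have "mset xs = mset (remove1 x ys)" using Cons.prems(1)[symmetric] by simp
  then obtain c where c: "c \<noteq> 0" "basis_product (remove1 x ys) v = smult V c (basis_product xs v)"
    using Cons.IH[of "remove1 x ys"] Cons.prems(2) by auto
  have ys: "set ys = set (x # xs)" using mset_eq_setD[OF Cons.prems(1)] by simp
  then obtain d where "d \<noteq> 0"
    "basis_product ys v = smult V d (act V (basis_vector x) (basis_product (remove1 x ys) v))"
    using basis_product_remove1[OF _ assms(3), of ys x] Cons.prems(2) by auto
  with c show ?case using assms(3)
    by (intro exI[of _ "d * c"]) (simp add: act_scale)
qed

lemma basis_product_not_distinct:
  assumes "\<not> distinct bs" "\<forall>c\<in>set bs. qpar c = 1" "v \<in> carrier V"
  shows "basis_product bs v = 0"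
  using assms(1,2)
proof (induction bs)
  case (Cons b bs)
  show ?case
  proof (cases "b \<in> set bs")
    case True
    then obtain c where "basis_product bs v = smult V c (act V (basis_vector b) (basis_product (remove1 b bs) v))"
      using basis_product_remove1[OF _ assms(3), of bs b] Cons.prems by auto
    then show ?thesis using Cons.prems assms(3) by (simp add: act_scale act_closed odd_square)
  next
    case False then show ?thesis using Cons by simp
  qed
qed simp

text \<open>
  If a product of \<open>k\<close> odd basis vectors, with degrees bounded by \<open>B\<close> in absolute value, does not
  annihilate the homogeneous vector \<open>w\<close>, then the products of two of them, applied to \<open>w\<close>, are
  linearly independent: the product of the remaining \<open>k - 2\<close> basis vectors separates each of
  these vectors from all the others. They lie in at most \<open>4 * B + 1\<close> degrees, which bounds their
  number.
\<close>
lemma choose_two_bound: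
  assumes nz: "basis_product bs w \<noteq> 0" and w: "w \<in> mdeg V j"
    and bs: "\<forall>b\<in>set bs. qpar b = 1 \<and> \<bar>qdeg b\<bar> \<le> int B"
    and N: "\<And>n X. finite X \<Longrightarrow> X \<subseteq> mdeg V n \<Longrightarrow> deg.independent X \<Longrightarrow> card X \<le> N"
  shows "length bs choose 2 \<le> N * (4 * B + 1)"
proof -
  have wV: "w \<in> carrier V" using w by (rule deg.D_W)
  have dist: "distinct bs" using nz basis_product_not_distinct bs wV by blast
  define S where "S = set bs"
  \<comment> \<open>Up to sign, a product of distinct factors depends only on their set, so any enumeration \<open>lst I\<close>
    of a set \<open>I\<close> of factors will do.\<close>
  define lst where "lst I = (SOME xs. set xs = I \<and> distinct xs)" for I :: "qbasis set"
  have lst: "set (lst I) = I \<and> distinct (lst I)" if "I \<subseteq> S" for I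
    unfolding lst_def
    by (rule someI_ex[OF finite_distinct_list]) (use that in \<open>simp add: S_def finite_subset\<close>)
  define P where "P = {I. I \<subseteq> S \<and> card I = 2}"
  have finP: "finite P" unfolding P_def by (rule finite_subset[of _ "Pow S"]) (auto simp: S_def)
  have cardP: "card P = length bs choose 2"
    unfolding P_def using n_subsets[of S 2] dist by (simp add: S_def distinct_card)
  let ?f = "\<lambda>I. basis_product (lst I) w"
  let ?g = "\<lambda>I. basis_product (lst (S - I))"
  have sep: "?g I (?f J) = 0 \<longleftrightarrow> I \<noteq> J" if I: "I \<in> P" and J: "J \<in> P" for I J
  proof -
    have l: "set (lst (S - I)) = S - I" "distinct (lst (S - I))" "set (lst J) = J" "distinct (lst J)"
      using lst[of "S - I"] lst[of J] J by (auto simp: P_def)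
    have sub: "J \<subseteq> S" "I \<subseteq> S" "card I = card J" "finite J"
      using I J by (auto simp: P_def S_def intro: finite_subset)
    have odd: "\<forall>c\<in>set (lst (S - I) @ lst J). qpar c = 1"
      using l sub bs by (auto simp: S_def)
    show ?thesis
    proof (cases "I = J")
      case True
      have "mset (lst (S - I) @ lst J) = mset bs"
        using l sub dist True by (subst set_eq_iff_mset_eq_distinct[symmetric]) (auto simp: S_def)
      then obtain c where "basis_product bs w = smult V c (basis_product (lst (S - I) @ lst J) w)"
        using basis_product_perm[OF _ odd wV] by blast
      then show ?thesis using nz True by auto
    next
      case False
      then have "\<not> J \<subseteq> I" using sub card_subset_eq[of I J] finite_subset[of I S] by (auto simp: S_def)
      \<comment> \<open>Some factor of \<open>lst J\<close> lies outside \<open>I\<close>, hence occurs twice.\<close>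
      then have "\<not> distinct (lst (S - I) @ lst J)" using l sub by auto
      then have "basis_product (lst (S - I) @ lst J) w = 0"
        using basis_product_not_distinct[OF _ odd wV] by blast
      then show ?thesis using False by simp
    qed
  qed
  have indep: "inj_on ?f P" "deg.independent (?f ` P)"
    by (rule deg.independent_by_separation[OF finP, where g = ?g];
        simp add: wV sep basis_product_linear)+
  let ?R = "{- 2 * int B..2 * int B}"
  define Q where "Q m = {I \<in> P. sum_list (map qdeg (lst I)) = m}" for m
  have "P = (\<Union>m\<in>?R. Q m)"
  proof -
    have "sum_list (map qdeg (lst I)) \<in> ?R" if "I \<in> P" for I
    proof -
      have "length (lst I) = 2" "set (lst I) \<subseteq> S"
        using that lst[of I] distinct_card[of "lst I"] by (auto simp: P_def)
      then obtain a b where "lst I = [a, b]" "a \<in> S" "b \<in> S"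
        by (auto simp: numeral_2_eq_2 length_Suc_conv)
      moreover from this have "\<bar>qdeg a\<bar> \<le> int B" "\<bar>qdeg b\<bar> \<le> int B" using bs by (auto simp: S_def)
      ultimately show ?thesis by auto
    qed
    then show ?thesis by (auto simp: Q_def)
  qed
  then have "card P \<le> (\<Sum>m\<in>?R. card (Q m))" using card_UN_le[of ?R Q] by simp
  also have "\<dots> \<le> (\<Sum>m\<in>?R. N)"
  proof (rule sum_mono)
    fix m
    have QP: "Q m \<subseteq> P" by (auto simp: Q_def)
    have "card (?f ` Q m) \<le> N"
    proof (rule N)
      show "finite (?f ` Q m)" using QP finP finite_subset by blast
      show "?f ` Q m \<subseteq> mdeg V (m + j)" using basis_product_deg[OF w] by (auto simp: Q_def)
      show "deg.independent (?f ` Q m)" by (rule deg.independent_mono[OF indep(2)]) (use QP in blast)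
    qed
    then show "card (Q m) \<le> N" using card_image[OF inj_on_subset[OF indep(1) QP]] by simp
  qed
  also have "\<dots> = N * (4 * B + 1)" by (simp add: nat_add_distrib nat_mult_distrib algebra_simps)
  finally show ?thesis using cardP by simp
qed

text \<open>
  The vectors obtained from vectors homogeneous for both gradings by applying \<open>k\<close> odd basis
  vectors with degrees bounded by \<open>B\<close> in absolute value.
\<close>
definition odd_products :: "nat \<Rightarrow> nat \<Rightarrow> 'v set" where
  "odd_products k B = {basis_product bs w | bs w.
     length bs = k \<and> (\<forall>b\<in>set bs. qpar b = 1 \<and> \<bar>qdeg b\<bar> \<le> int B) \<and> w \<in> homogeneous}"

lemma odd_products_homogeneous: "odd_products k B \<subseteq> homogeneous"
  by (auto simp: odd_products_def basis_product_homogeneous)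

lemma odd_products_carrier: "odd_products k B \<subseteq> carrier V"
  using odd_products_homogeneous homogeneous_carrier by blast

lemma odd_products_mono: "B \<le> C \<Longrightarrow> odd_products k B \<subseteq> odd_products k C"
  unfolding odd_products_def by fastforce

lemma odd_products_Suc:
  assumes "qpar b = 1" "\<bar>qdeg b\<bar> \<le> int B" "v \<in> deg.span (odd_products k B)"
  shows "act V (basis_vector b) v \<in> deg.span (odd_products (Suc k) B)"
proof (rule act_span[OF _ odd_products_carrier _ assms(3)])
  fix p assume "p \<in> odd_products k B"
  then obtain bs w where "p = basis_product bs w" "length bs = k"
    "\<forall>b\<in>set bs. qpar b = 1 \<and> \<bar>qdeg b\<bar> \<le> int B" "w \<in> homogeneous"
    by (auto simp: odd_products_def)
  then show "act V (basis_vector b) p \<in> deg.span (odd_products (Suc k) B)"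
    using assms by (intro deg.span_base) (auto simp: odd_products_def intro!: exI[of _ "b # bs"])
qed simp

lemma S2_act_odd_products:
  assumes "\<forall>b\<in>set bs. qpar b = 1 \<and> \<bar>qdeg b\<bar> \<le> int B" "w \<in> homogeneous"
  shows "act V (basis_vector (S2 k)) (basis_product bs w)
    \<in> deg.span (odd_products (length bs) (B + nat \<bar>4 * k + 2\<bar>))"
  using assms(1)
proof (induction bs)
  case Nil
  then show ?case
    using homogeneous_act[OF _ assms(2), of "basis_vector (S2 k)"]
    by (intro deg.span_base) (auto simp: odd_products_def generators_def intro!: exI[of _ "[]"])
next
  case (Cons b bs)
  let ?C = "B + nat \<bar>4 * k + 2\<bar>"
  have w: "w \<in> carrier V" using assms homogeneous_carrier by auto
  have b: "qpar b = 1" "\<bar>qdeg b\<bar> \<le> int ?C" "\<bar>qdeg (qshift k b)\<bar> \<le> int ?C"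
    using Cons.prems qshift(3)[of b k] by auto
  have "act V (basis_vector (S2 k)) (basis_product (b # bs) w)
     = act V (basis_vector (qshift k b)) (basis_product bs w)
       + act V (basis_vector b) (act V (basis_vector (S2 k)) (basis_product bs w))"
    using qbr_act[of "basis_product bs w" "S2 k" b] w
    by (simp add: qshift b ksign_def basis_vector_def[symmetric] algebra_simps)
  moreover have "basis_product bs w \<in> deg.span (odd_products (length bs) ?C)"
    using Cons.prems assms(2) by (intro deg.span_base) (force simp: odd_products_def)
  ultimately show ?case
    using odd_products_Suc[OF b(1,2) Cons.IH] odd_products_Suc[OF qshift(2)[OF b(1)] b(3)] Cons.prems
    by (simp add: deg.span_add)
qed

text \<open>
  A generator enlarges the bound on the degrees of the \<open>k\<close> odd factors by a constant that depends
  on neither \<open>k\<close> nor the bound: elements of \<open>A\<close> and odd elements move past the factors up to sign,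
  while \<open>s\<^sup>m\<close> acts as a derivation that raises the degree of one factor by \<open>m\<close>.
\<close>
lemma generator_act_odd_products:
  assumes "x \<in> generators A"
  shows "\<exists>C. \<forall>k B. \<forall>v\<in>deg.span (odd_products k B). act V x v \<in> deg.span (odd_products k (B + C))"
proof -
  have x: "x \<in> carrier G" using assms by (rule generators_carrier)
  have "\<exists>C. \<forall>B bs w. (\<forall>b\<in>set bs. qpar b = 1 \<and> \<bar>qdeg b\<bar> \<le> int B) \<longrightarrow> w \<in> homogeneous \<longrightarrow>
    act V x (basis_product bs w) \<in> deg.span (odd_products (length bs) (B + C))"
  proof -
    \<comment> \<open>A generator that moves past the odd factors up to a scalar does not change the bound.\<close>
    have I: ?thesis if "\<And>bs w. \<forall>b\<in>set bs. qpar b = 1 \<Longrightarrow> w \<in> homogeneous \<Longrightarrow>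
       \<exists>c. act V x (basis_product bs w) = smult V c (basis_product bs (act V x w))"
    proof (intro exI[of _ 0] allI impI)
      fix B bs w
      assume bs: "\<forall>b\<in>set bs. qpar b = 1 \<and> \<bar>qdeg b\<bar> \<le> int B" and w: "w \<in> homogeneous"
      then have "basis_product bs (act V x w) \<in> odd_products (length bs) (B + 0)"
        using homogeneous_act[OF assms] unfolding odd_products_def by auto
      then show "act V x (basis_product bs w) \<in> deg.span (odd_products (length bs) (B + 0))"
        using that[of bs w] bs w by (metis deg.span_scale deg.span_base)
    qed
    show ?thesis
      using assms
    proof (cases rule: generators_cases)
      case (abelian a)
      show ?thesis
        by (rule I, intro exI[of _ 1])
          (use abelian homogeneous_carrier in \<open>auto simp: A_act_basis_product\<close>)
    next
      case s then show ?thesis using S2_act_odd_products by blast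
    next
      case t2
      then show ?thesis
        using homogeneous_carrier by (auto intro!: exI[of _ 0] deg.span_zero simp: T2_act_0 subset_iff)
    next
      case odd
      show ?thesis by (rule I) (use odd odd_act_basis_product homogeneous_carrier in blast)
    qed
  qed
  then obtain C where C: "\<And>B bs w. \<forall>b\<in>set bs. qpar b = 1 \<and> \<bar>qdeg b\<bar> \<le> int B \<Longrightarrow> w \<in> homogeneous \<Longrightarrow>
    act V x (basis_product bs w) \<in> deg.span (odd_products (length bs) (B + C))" by blast
  have "act V x v \<in> deg.span (odd_products k (B + C))" if "v \<in> deg.span (odd_products k B)" for k B v
  proof (rule act_span[OF x odd_products_carrier _ that])
    fix p assume "p \<in> odd_products k B"
    then obtain bs w where "p = basis_product bs w" "length bs = k"
      "\<forall>b\<in>set bs. qpar b = 1 \<and> \<bar>qdeg b\<bar> \<le> int B" "w \<in> homogeneous"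
      by (auto simp: odd_products_def)
    then show "act V x p \<in> deg.span (odd_products k (B + C))" using C by blast
  qed
  then show ?thesis by blast
qed

text \<open>
  Suppose that \<open>u = b v\<close> is nonzero for an odd basis vector \<open>b\<close>. By simplicity \<open>v\<close> is obtained from
  \<open>u\<close> by an operator of \<open>G\<close>. This operator increases the bound on the degrees of odd factors by
  some constant \<open>C\<close>; so writing \<open>v\<close> in terms of \<open>b v\<close>, and iterating, exhibits \<open>v\<close> as a combination of
  products of \<open>k\<close> odd factors with degrees at most \<open>B0 + k * C\<close>, for every \<open>k\<close>. As the number of
  pairs of factors is quadratic in \<open>k\<close>, and the bound on it from \<open>choose_two_bound\<close> is linear in \<open>k\<close>, this
  is impossible.
\<close>
lemma odd_acts_trivially:
  assumes simple: "graded_simple_module G V"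
    and N: "\<And>n X. finite X \<Longrightarrow> X \<subseteq> mdeg V n \<Longrightarrow> deg.independent X \<Longrightarrow> card X \<le> N"
    and b: "qpar b = 1" and v: "v \<in> carrier V"
  shows "act V (basis_vector b) v = 0"
proof (rule ccontr)
  define u where "u = act V (basis_vector b) v"
  assume "act V (basis_vector b) v \<noteq> 0"
  then have "u \<noteq> 0" by (simp add: u_def)
  let ?E = "\<lambda>k B. deg.span (odd_products k B)"
  \<comment> \<open>Replacing \<open>u\<close> by \<open>y \<in> Y\<close> raises the degree bound by at most a constant. These \<open>y\<close> form a graded
    submodule.\<close>
  define Y where "Y = {y \<in> carrier V. \<exists>C. \<forall>k B. u \<in> ?E k B \<longrightarrow> y \<in> ?E k (B + C)}"
  have YI: "y \<in> Y" if "y \<in> carrier V" "\<And>k B. u \<in> ?E k B \<Longrightarrow> y \<in> ?E k (B + C)" for y C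
    using that by (auto simp: Y_def)
  have YE: "\<exists>C. \<forall>k B. u \<in> ?E k B \<longrightarrow> y \<in> ?E k (B + C)" if "y \<in> Y" for y
    using that by (auto simp: Y_def)
  have YV: "Y \<subseteq> carrier V" by (auto simp: Y_def)
  have mono: "y \<in> ?E k B \<Longrightarrow> B \<le> C \<Longrightarrow> y \<in> ?E k C" for y k B C
    using deg.span_mono[OF odd_products_mono] by blast
  have "graded_submodule G V Y"
  proof (rule graded_submoduleI)
    show "deg.subspace Y"
    proof (rule deg.subspaceI)
      show "0 \<in> Y" by (rule YI[of _ 0]) (simp_all add: deg.subspace_0[OF deg.W] deg.span_zero)
    next
      fix x y assume xy: "x \<in> Y" "y \<in> Y"
      obtain C where C: "\<And>k B. u \<in> ?E k B \<Longrightarrow> x \<in> ?E k (B + C)" using YE[OF xy(1)] by blast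
      obtain C' where C': "\<And>k B. u \<in> ?E k B \<Longrightarrow> y \<in> ?E k (B + C')" using YE[OF xy(2)] by blast
      show "x + y \<in> Y"
      proof (rule YI[of _ "C + C'"])
        show "x + y \<in> carrier V" using xy YV by (auto intro: deg.subspace_add[OF deg.W])
        show "x + y \<in> ?E k (B + (C + C'))" if "u \<in> ?E k B" for k B
          by (intro deg.span_add mono[OF C[OF that]] mono[OF C'[OF that]]) auto
      qed
    next
      fix c x assume x: "x \<in> Y"
      obtain C where C: "\<And>k B. u \<in> ?E k B \<Longrightarrow> x \<in> ?E k (B + C)" using YE[OF x] by blast
      show "smult V c x \<in> Y"
        by (rule YI[of _ C]) (use x YV C in \<open>auto intro: deg.subspace_scale[OF deg.W] deg.span_scale\<close>)
    qed
    fix y assume y: "y \<in> Y"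
    have yV: "y \<in> carrier V" using y YV by auto
    obtain C where C: "\<And>k B. u \<in> ?E k B \<Longrightarrow> y \<in> ?E k (B + C)" using YE[OF y] by blast
    have hom: "odd_products k B \<subseteq> (\<Union>n. mdeg V n)" "odd_products k B \<subseteq> (\<Union>i. par V i)" for k B
      using odd_products_homogeneous[of k B] by (auto simp: homogeneous_def)
    show "hcomp (par V) y i \<in> Y" for i
      by (rule YI[of _ C]) (simp_all add: par.hcomp_W yV par.span_hcomp[OF hom(2)] C)
    show "hcomp (mdeg V) y n \<in> Y" for n
      by (rule YI[of _ C]) (simp_all add: deg.hcomp_W yV deg.span_hcomp[OF hom(1)] C)
    fix x assume x: "x \<in> generators A"
    obtain C' where C': "\<And>k B v. v \<in> ?E k B \<Longrightarrow> act V x v \<in> ?E k (B + C')"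
      using generator_act_odd_products[OF x] by blast
    show "act V x y \<in> Y"
      by (rule YI[of _ "C + C'"]) (use C C' act_closed[OF generators_carrier[OF x] yV] in \<open>auto simp: add.assoc[symmetric]\<close>)
  qed (rule YV)
  moreover have "u \<in> Y" by (rule YI[of _ 0]) (simp_all add: u_def act_closed v)
  ultimately have "Y = carrier V"
    using simple \<open>u \<noteq> 0\<close> by (auto simp: graded_simple_module_def)
  then obtain C where C: "\<And>k B. u \<in> ?E k B \<Longrightarrow> v \<in> ?E k (B + C)"
    using YE[of v] v by blast
  define B0 where "B0 = nat \<bar>qdeg b\<bar>"
  have vE: "v \<in> ?E k (B0 + k * C)" for k
  proof (induction k)
    case 0
    have "odd_products 0 B = homogeneous" for B by (auto simp: odd_products_def)
    then show ?case using v span_homogeneous by simp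
  next
    case (Suc k)
    have "u \<in> ?E (Suc k) (B0 + k * C)"
      unfolding u_def by (rule odd_products_Suc[OF b _ Suc]) (simp add: B0_def)
    from C[OF this] show ?case by (simp add: algebra_simps)
  qed
  have "v \<noteq> 0" using \<open>u \<noteq> 0\<close> by (auto simp: u_def)
  have bound: "k choose 2 \<le> N * (4 * (B0 + k * C) + 1)" for k
  proof -
    have "\<not> odd_products k (B0 + k * C) \<subseteq> {0}"
      using vE[of k] \<open>v \<noteq> 0\<close> deg.span_mono[of _ "{0}"] by (metis deg.span_insert_0 deg.span_empty singletonD subsetD)
    then obtain bs w where "basis_product bs w \<noteq> 0" "length bs = k" "w \<in> homogeneous"
      "\<forall>b\<in>set bs. qpar b = 1 \<and> \<bar>qdeg b\<bar> \<le> int (B0 + k * C)"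
      by (auto simp: odd_products_def)
    then show ?thesis
      using choose_two_bound[of bs w _ "B0 + k * C" N] N by (auto elim!: homogeneousE)
  qed
  \<comment> \<open>This \<open>k\<close> satisfies \<open>k choose 2 = (M + 1) * (2 * M + 1) > M * k\<close>.\<close>
  define M where "M = N * (4 * B0 + 4 * C + 1)"
  define k where "k = 2 * M + 2"
  have "k * (k - 1) div 2 \<le> N * (4 * (B0 + k * C) + 1)" using bound[of k] by (simp add: choose_two)
  also have "\<dots> \<le> N * ((4 * B0 + 4 * C + 1) * k)"
    by (rule mult_left_mono) (simp_all add: k_def algebra_simps)
  also have "\<dots> = M * k" by (simp only: M_def mult.assoc)
  also have "\<dots> < (M + 1) * (2 * M + 1)" by (simp add: k_def algebra_simps)
  also have "\<dots> = k * (k - 1) div 2" by (simp add: k_def algebra_simps)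
  finally show False by simp
qed

end

section \<open>Quotients and images of modules\<close>

lemma (in graded_space) hcomp_image:
  assumes f: "linear_on s W s' f" and s': "vector_space s'"
    and ker: "\<And>w i. w \<in> W \<Longrightarrow> f w = 0 \<Longrightarrow> f (hcomp D w i) = 0" and w: "w \<in> W"
  shows "hcomp (\<lambda>i. f ` D i) (f w) i = f (hcomp D w i)"
proof -
  interpret t: graded_space s' "f ` W" "\<lambda>i. f ` D i"
    using direct_image[OF f s' ker] s' by (simp add: graded_space_def graded_space_axioms_def)
  let ?F = "insert i (Poly_Mapping.keys (components D w))"
  have "f w = f (\<Sum>j\<in>?F. hcomp D w j)" by (subst hcomp_sum) (auto simp: w)
  also have "\<dots> = (\<Sum>j\<in>?F. f (hcomp D w j))"
    by (rule linear_on_sum[OF f]) (auto intro: hcomp_W w)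
  finally show ?thesis
    using t.hcomp_eqI[of ?F "\<lambda>j. f (hcomp D w j)" i] hcomp_in[OF w] by auto
qed

text \<open>
  A subspace \<open>N\<close> of finite codimension in \<open>W\<close> is the kernel of a linear map into the finitely
  supported sequences. The map takes coordinates along the part of a basis of \<open>W\<close> that lies outside
  a basis of \<open>N\<close>.
\<close>
lemma (in vector_subspace) finite_quotient:
  assumes N: "subspace N" "N \<subseteq> W" and B: "finite B" "B \<subseteq> W"
    and W_le: "\<And>v. v \<in> W \<Longrightarrow> \<exists>n\<in>N. v - n \<in> span B"
  obtains \<phi> :: "'v \<Rightarrow> nat \<Rightarrow>\<^sub>0 complex"
  where "linear_on s W qscale \<phi>" "\<And>v. v \<in> W \<Longrightarrow> \<phi> v = 0 \<longleftrightarrow> v \<in> N" "finite_dim qscale (\<phi> ` W)"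
proof -
  obtain C where C: "C \<subseteq> N" "independent C" "N \<subseteq> span C"
    using maximal_independent_subset[of N] by blast
  have spanC: "span C = N" using C span_minimal[OF C(1) N(1)] by auto
  obtain X where X: "C \<subseteq> X" "X \<subseteq> C \<union> B" "independent X" "C \<union> B \<subseteq> span X"
    using maximal_independent_subset_extend[of C "C \<union> B"] C(2) by blast
  have WX: "v \<in> span X" if v: "v \<in> W" for v
  proof -
    obtain n where n: "n \<in> N" "v - n \<in> span B" using W_le[OF v] by blast
    have "n \<in> span X" using n(1) span_mono[OF X(1)] spanC by blast
    moreover have "v - n \<in> span X"
      using n(2) span_minimal[of B "span X"] X(4) by (auto simp: subspace_span)
    ultimately show ?thesis using span_add[of n X "v - n"] by simp
  qed
  define E where "E = X - C"
  have "finite E" using X(2) B(1) by (auto simp: E_def intro: finite_subset[of _ B])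
  then obtain idx :: "'v \<Rightarrow> nat" where idx: "inj_on idx E"
    using finite_imp_inj_to_nat_seg by blast
  define \<phi> where "\<phi> v = (\<Sum>x\<in>E. Poly_Mapping.single (idx x) (representation X v x))" for v
  have lin: "linear_on s W qscale \<phi>"
    unfolding linear_on_def \<phi>_def
  proof (intro conjI ballI allI)
    fix x y assume "x \<in> W" "y \<in> W"
    then show "(\<Sum>e\<in>E. Poly_Mapping.single (idx e) (representation X (x + y) e)) =
      (\<Sum>e\<in>E. Poly_Mapping.single (idx e) (representation X x e)) +
      (\<Sum>e\<in>E. Poly_Mapping.single (idx e) (representation X y e))"
      by (simp add: representation_add[OF X(3)] WX single_add sum.distrib)
  next
    fix c x assume "x \<in> W"
    then show "(\<Sum>e\<in>E. Poly_Mapping.single (idx e) (representation X (s c x) e)) =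
      qscale c (\<Sum>e\<in>E. Poly_Mapping.single (idx e) (representation X x e))"
      by (intro poly_mapping_eqI)
        (auto simp: representation_scale[OF X(3)] WX lookup_sum sum_distrib_left lookup_single when_def
          intro!: sum.cong)
  qed
  have ker: "\<phi> v = 0 \<longleftrightarrow> v \<in> N" if v: "v \<in> W" for v
  proof
    assume z: "\<phi> v = 0"
    have rep: "representation X v x = 0" if x: "x \<in> E" for x
    proof -
      have "Poly_Mapping.lookup (\<phi> v) (idx x) = (\<Sum>e\<in>E. if e = x then representation X v x else 0)"
        unfolding \<phi>_def lookup_sum
        by (intro sum.cong) (use x idx in \<open>auto simp: lookup_single when_def inj_on_def\<close>)
      then show ?thesis using x \<open>finite E\<close> z by simp
    qed
    have "(\<Sum>b | representation X v b \<noteq> 0. s (representation X v b) b) \<in> span C"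
    proof (intro span_sum span_scale span_base)
      fix b assume "b \<in> {b. representation X v b \<noteq> 0}"
      then show "b \<in> C" using rep[of b] representation_ne_zero[of X v b] by (auto simp: E_def)
    qed
    then show "v \<in> N" using sum_nonzero_representation_eq[OF X(3) WX[OF v]] spanC by simp
  next
    assume "v \<in> N"
    then have "representation X v = representation C v"
      using representation_extend[OF X(3) _ X(1)] spanC by simp
    then have "representation X v x = 0" if "x \<in> E" for x
      using that representation_ne_zero[of C v x] by (auto simp: E_def)
    then show "\<phi> v = 0" by (simp add: \<phi>_def)
  qed
  interpret t: vector_space qscale by (rule vector_space_qscale)
  have "finite_dim qscale (\<phi> ` W)"
    unfolding finite_dim_def
  proof (intro exI[of _ "\<phi> ` B"] conjI)
    show "t.span (\<phi> ` B) = \<phi> ` W"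
    proof
      show "t.span (\<phi> ` B) \<subseteq> \<phi> ` W"
        using B(2) by (intro t.span_minimal subspace_image[OF lin vector_space_qscale W]) auto
      have "subspace {v \<in> W. \<phi> v \<in> t.span (\<phi> ` B)}"
        by (rule subspace_vimage[OF lin vector_space_qscale t.subspace_span])
      then have sp: "span B \<subseteq> {v \<in> W. \<phi> v \<in> t.span (\<phi> ` B)}"
        using B(2) by (intro span_minimal) (auto intro: t.span_base)
      show "\<phi> ` W \<subseteq> t.span (\<phi> ` B)"
      proof
        fix y assume "y \<in> \<phi> ` W"
        then obtain v where v: "v \<in> W" "y = \<phi> v" by blast
        obtain n where n: "n \<in> N" "v - n \<in> span B" using W_le[OF v(1)] by blast
        have "\<phi> (v - n) = y" using linear_on_diff[OF lin v(1), of n] ker[of n] n N v by auto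
        then show "y \<in> t.span (\<phi> ` B)" using sp n(2) by auto
      qed
    qed
  qed (use B in auto)
  then show ?thesis using that lin ker by blast
qed

context quadratic_module
begin

text \<open>
  In the next lemmas \<open>M\<close> is the image of \<open>V\<close> under a linear map \<open>f\<close> whose kernel is graded, with the
  structure induced from \<open>V\<close>. This covers quotients of \<open>V\<close> as well as isomorphic copies.
\<close>
lemma super_module_image:
  fixes M :: "('a \<times> quad, 'w::ab_group_add, 'm) gmodule_scheme"
  assumes M: "carrier M = f ` carrier V" "\<And>i. par M i = f ` par V i"
    and s: "vector_space (smult M)" and f: "linear_on (smult V) (carrier V) (smult M) f"
    and ker: "\<And>v i. v \<in> carrier V \<Longrightarrow> f v = 0 \<Longrightarrow> f (hcomp (par V) v i) = 0"
    and act: "\<And>x v. x \<in> carrier G \<Longrightarrow> v \<in> carrier V \<Longrightarrow> act M x (f v) = f (act V x v)"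
  shows "super_module G M"
proof -
  have parM: "par M = (\<lambda>i. f ` par V i)" using M by auto
  have parG: "x \<in> carrier G" if "x \<in> par G i" for x i
    using that Ap.D_W by (auto simp: G_def)
  show ?thesis
    unfolding super_module_def
  proof (intro conjI allI ballI)
    show "superspace M"
      unfolding superspace_def M(1) parM using par.direct_image[OF f s ker] s by blast
    show "bilinear_on (smult G) (carrier G) (smult M) (carrier M) (smult M) (act M)"
      unfolding bilinear_on_def
    proof (intro conjI ballI)
      show "linear_on (smult M) (carrier M) (smult M) (act M x)" if "x \<in> carrier G" for x
        unfolding linear_on_def M(1)
        using that
        by (auto simp: linear_on_add[OF f, symmetric] linear_on_scale[OF f, symmetric] act act_add act_scale
          act_closed deg.subspace_add[OF deg.W] deg.subspace_scale[OF deg.W])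
      show "linear_on (smult G) (carrier G) (smult M) (\<lambda>x. act M x y)" if y: "y \<in> carrier M" for y
      proof -
        obtain v where v: "y = f v" "v \<in> carrier V" using y unfolding M(1) by blast
        show ?thesis
          unfolding linear_on_def v(1) using v(2) G.subspace_add[OF G.W] G.subspace_scale[OF G.W]
          by (simp add: linear_on_add[OF f, symmetric] linear_on_scale[OF f, symmetric] act act_add_left
            act_scale_left act_closed)
      qed
    qed
    show "act M x v \<in> par M (i + j)" if x: "x \<in> par G i" and v: "v \<in> par M j" for i j x v
    proof -
      obtain u where u: "v = f u" "u \<in> par V j" using v M(2) by blast
      show ?thesis
        unfolding u(1) act[OF parG[OF x] par.D_W[OF u(2)]] M(2) using act_par[OF x u(2)] by (rule imageI)
    qed
    show "act M (bracket G x y) v = act M x (act M y v) - smult M (ksign i j) (act M y (act M x v))"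
      if x: "x \<in> par G i" and y: "y \<in> par G j" and v: "v \<in> carrier M" for i j x y v
    proof -
      obtain u where u: "v = f u" "u \<in> carrier V" using v M(1) by auto
      have "bracket G x y \<in> carrier G"
      proof -
        obtain a q b r where "x = (a, q)" "y = (b, r)" by (cases x, cases y)
        then show ?thesis using parG[OF x] parG[OF y] by (auto simp: G_def)
      qed
      then show ?thesis
        using u parG[OF x] parG[OF y]
        by (simp add: act act_closed act_bracket[OF x y] deg.linear_on_diff[OF f] linear_on_scale[OF f]
          deg.subspace_scale[OF deg.W])
    qed
  qed
qed

lemma submodule_vimage:
  fixes M :: "('a \<times> quad, 'w::ab_group_add, 'm) gmodule_scheme"
  assumes M: "carrier M = f ` carrier V" "\<And>i. par M i = f ` par V i"
    and s: "vector_space (smult M)" and f: "linear_on (smult V) (carrier V) (smult M) f"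
    and ker: "\<And>v i. v \<in> carrier V \<Longrightarrow> f v = 0 \<Longrightarrow> f (hcomp (par V) v i) = 0"
    and act: "\<And>x v. x \<in> carrier G \<Longrightarrow> v \<in> carrier V \<Longrightarrow> act M x (f v) = f (act V x v)"
    and X: "submodule G M X"
  shows "submodule G V {v \<in> carrier V. f v \<in> X}"
proof (rule submoduleI)
  have parM: "par M = (\<lambda>i. f ` par V i)" using M by auto
  interpret t: graded_space "smult M" "carrier M" "par M"
    using par.direct_image[OF f s ker] s M(1) parM by (simp add: graded_space_def graded_space_axioms_def)
  show "deg.subspace {v \<in> carrier V. f v \<in> X}"
    using X by (intro deg.subspace_vimage[OF f s]) (simp add: submodule_def)
  show "hcomp (par V) v i \<in> {v \<in> carrier V. f v \<in> X}" if v: "v \<in> {v \<in> carrier V. f v \<in> X}" for v i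
  proof -
    have "f (hcomp (par V) v i) = hcomp (par M) (f v) i"
      unfolding parM using par.hcomp_image[OF f s ker, of v i] v by simp
    also have "\<dots> \<in> X" using v X by (intro t.direct_subD) (auto simp: submodule_def)
    finally show ?thesis using v by (simp add: par.hcomp_W)
  qed
  show "act V x v \<in> {v \<in> carrier V. f v \<in> X}"
    if x: "x \<in> generators A" and v: "v \<in> {v \<in> carrier V. f v \<in> X}" for x v
    using v X generators_carrier[OF x] by (auto simp: submodule_def act_closed act[symmetric])
qed auto

lemma graded_simple_image:
  fixes M :: "('a \<times> quad, 'w::ab_group_add, 'm) graded_gmodule_scheme"
  assumes simple: "graded_simple_module G V"
    and M: "carrier M = f ` carrier V" "\<And>i. par M i = f ` par V i" "\<And>n. mdeg M n = f ` mdeg V n"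
    and s: "vector_space (smult M)" and f: "linear_on (smult V) (carrier V) (smult M) f"
    and inj: "\<And>v. v \<in> carrier V \<Longrightarrow> f v = 0 \<Longrightarrow> v = 0"
    and act: "\<And>x v. x \<in> carrier G \<Longrightarrow> v \<in> carrier V \<Longrightarrow> act M x (f v) = f (act V x v)"
  shows "graded_simple_module G M"
proof -
  have kerp: "f (hcomp (par V) v i) = 0" if "v \<in> carrier V" "f v = 0" for v i
    using inj[OF that] deg.linear_on_0[OF f] by simp
  have kerd: "f (hcomp (mdeg V) v i) = 0" if "v \<in> carrier V" "f v = 0" for v i
    using inj[OF that] deg.linear_on_0[OF f] by simp
  have inj': "inj_on f (carrier V)"
    by (rule inj_onI) (metis deg.linear_on_diff[OF f] inj deg.subspace_diff[OF deg.W] right_minus_eq)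
  have mdegM: "mdeg M = (\<lambda>n. f ` mdeg V n)" using M by auto
  have sup: "super_module G M" by (rule super_module_image[OF M(1,2) s f kerp act])
  have dirM: "internal_direct_sum (smult M) (carrier M) (mdeg M)"
    using deg.direct_image[OF f s kerd] by (simp add: M(1) mdegM)
  interpret t: graded_space "smult M" "carrier M" "mdeg M"
    using dirM s by (simp add: graded_space_def graded_space_axioms_def)
  have "graded_superspace M (mdeg M)"
    unfolding graded_superspace_def
  proof (intro conjI allI)
    show "superspace M" using sup by (simp add: super_module_def)
    show "internal_direct_sum (smult M) (carrier M) (mdeg M)" by (rule dirM)
    fix n
    interpret q: graded_space "smult V" "mdeg V n" "\<lambda>i. mdeg V n \<inter> par V i"
      using V deg.vector_space_axioms
      by (simp add: graded_space_def graded_space_axioms_def graded_module_def graded_superspace_def)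
    have "linear_on (smult V) (mdeg V n) (smult M) f"
      using f deg.D_W by (auto simp: linear_on_def)
    then have "internal_direct_sum (smult M) (f ` mdeg V n) (\<lambda>i. f ` (mdeg V n \<inter> par V i))"
    proof (rule q.direct_image[OF _ s])
      show "f (hcomp (\<lambda>i. mdeg V n \<inter> par V i) v i) = 0" if "v \<in> mdeg V n" "f v = 0" for v i
        using inj[OF deg.D_W[OF that(1)] that(2)] deg.linear_on_0[OF f] by simp
    qed
    moreover have "f ` (mdeg V n \<inter> par V i) = mdeg M n \<inter> par M i" for i
      unfolding M using deg.D(2) par.D(2) by (rule inj_on_image_Int[OF inj'])
    ultimately show "internal_direct_sum (smult M) (mdeg M n) (\<lambda>i. mdeg M n \<inter> par M i)"
      by (simp add: M(3))
  qed
  moreover have "act M x w \<in> mdeg M (k + m)" if x: "x \<in> ldeg G k" and w: "w \<in> mdeg M m" for k m x w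
    using w act_deg[OF x] by (auto simp: M(3) act[OF G.D_W[OF x] deg.D_W])
  ultimately have "graded_module G M" using sup by (simp add: graded_module_def)
  moreover have "carrier M \<noteq> {0}"
  proof -
    obtain v where "v \<in> carrier V" "v \<noteq> 0"
      using simple deg.subspace_0[OF deg.W] by (auto simp: graded_simple_module_def)
    then show ?thesis using inj[of v] by (auto simp: M(1))
  qed
  moreover have "X = {0} \<or> X = carrier M" if X: "graded_submodule G M X" for X
  proof -
    let ?Y = "{v \<in> carrier V. f v \<in> X}"
    have sub: "submodule G V ?Y"
      using X unfolding graded_submodule_def by (intro submodule_vimage[OF M(1,2) s f kerp act]) simp_all
    have "internal_direct_sum (smult V) ?Y (\<lambda>n. mdeg V n \<inter> ?Y)"
    proof (rule deg.direct_subI)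
      show "deg.subspace ?Y" by (rule submoduleD[OF sub])
      show "hcomp (mdeg V) v n \<in> ?Y" if v: "v \<in> ?Y" for v n
      proof -
        have "f (hcomp (mdeg V) v n) = hcomp (mdeg M) (f v) n"
          unfolding mdegM using deg.hcomp_image[OF f s kerd, of v n] v by simp
        also have "\<dots> \<in> X" using v X by (intro t.direct_subD) (auto simp: graded_submodule_def)
        finally show ?thesis using v by (simp add: deg.hcomp_W)
      qed
    qed auto
    then have "?Y = {0} \<or> ?Y = carrier V"
      using simple sub by (simp add: graded_simple_module_def graded_submodule_def)
    moreover have "X = f ` ?Y"
      using X M(1) by (auto simp: graded_submodule_def submodule_def)
    ultimately show ?thesis using deg.linear_on_0[OF f] M(1) by auto
  qed
  ultimately show ?thesis by (simp add: graded_simple_module_def)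
qed

end

section \<open>The action of a central element of nonzero degree\<close>

context quadratic_module
begin

text \<open>
  For the rest of this block, \<open>V\<close> is graded simple and \<open>t\<^sup>4\<^sup>k\<^sup>+\<^sup>2\<close> does not act as zero on it. This
  element is central, so its action \<open>t2\<close> is an endomorphism of the module, homogeneous of degree
  \<open>4 * k + 2\<close>, and it is bijective by Schur's argument.
\<close>
context
  fixes k :: int
  assumes simple: "graded_simple_module G V"
    and nontrivial: "\<exists>v\<in>carrier V. act V (basis_vector (T2 k)) v \<noteq> 0"
begin

text \<open>
  The action of \<open>t\<^sup>4\<^sup>k\<^sup>+\<^sup>2\<close>.
\<close>
definition "t2 = act V (basis_vector (T2 k))"

lemma t2_linear: "linear_on (smult V) (carrier V) (smult V) t2"
  unfolding t2_def by (rule act_linear) simp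

lemma t2_closed [simp]: "v \<in> carrier V \<Longrightarrow> t2 v \<in> carrier V"
  unfolding t2_def by (rule act_closed) simp

lemma hcomp_t2:
  assumes "v \<in> carrier V"
  shows "hcomp (par V) (t2 v) i = t2 (hcomp (par V) v i)"
    and "hcomp (mdeg V) (t2 v) n = t2 (hcomp (mdeg V) v (n - (4 * k + 2)))"
  using hcomp_act_par[OF basis_vector_carrier basis_vector_homogeneous(2) assms, of "T2 k" i]
    hcomp_act_deg[OF basis_vector_homogeneous(1) assms, of "T2 k" n]
  by (simp_all add: t2_def)

lemma t2_commute: "x \<in> carrier G \<Longrightarrow> v \<in> carrier V \<Longrightarrow> act V x (t2 v) = t2 (act V x v)"
  unfolding t2_def by (rule T2_act_commute)

lemma t2_inject: "v \<in> carrier V \<Longrightarrow> t2 v = 0 \<Longrightarrow> v = 0"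
proof -
  let ?K = "{v \<in> carrier V. t2 v \<in> {0}}"
  have "graded_submodule G V ?K"
  proof (rule graded_submoduleI)
    show "deg.subspace ?K"
      by (rule deg.subspace_vimage[OF t2_linear]) (auto intro: deg.vector_space_axioms deg.subspace_single_0)
    show "hcomp (mdeg V) v n \<in> ?K" if "v \<in> ?K" for v n
      using that hcomp_t2(2)[of v "n + (4 * k + 2)"] by (simp add: deg.hcomp_W)
    show "hcomp (par V) v i \<in> ?K" if "v \<in> ?K" for v i
      using that hcomp_t2(1)[of v i] by (simp add: par.hcomp_W)
    show "act V x v \<in> ?K" if "x \<in> generators A" "v \<in> ?K" for x v
      using that t2_commute[OF generators_carrier[OF that(1)], of v] act_closed[OF generators_carrier[OF that(1)], of v]
      by (simp add: generators_carrier)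
  qed auto
  then have "?K = {0} \<or> ?K = carrier V" using simple by (auto simp: graded_simple_module_def)
  then have K: "?K = {0}" using nontrivial by (auto simp: t2_def)
  show "v = 0" if "v \<in> carrier V" "t2 v = 0" using K that by blast
qed

lemma t2_image: "t2 ` carrier V = carrier V"
proof -
  let ?I = "t2 ` carrier V"
  have "graded_submodule G V ?I"
  proof (rule graded_submoduleI)
    show "deg.subspace ?I"
      by (rule deg.subspace_image[OF t2_linear deg.vector_space_axioms deg.W]) simp
    show "hcomp (mdeg V) v n \<in> ?I" if "v \<in> ?I" for v n
      using that by (auto simp: hcomp_t2 deg.hcomp_W)
    show "hcomp (par V) v i \<in> ?I" if "v \<in> ?I" for v i
      using that by (auto simp: hcomp_t2 par.hcomp_W)
    show "act V x v \<in> ?I" if "x \<in> generators A" "v \<in> ?I" for x v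
      using that by (auto simp: t2_commute generators_carrier act_closed)
  qed auto
  then have "?I = {0} \<or> ?I = carrier V" using simple by (auto simp: graded_simple_module_def)
  then show ?thesis using nontrivial by (auto simp: t2_def)
qed

text \<open>
  The image of \<open>t2 - 1\<close>. It is a \<open>\<int>\<^sub>2\<close>-graded submodule, but not a \<open>\<int>\<close>-graded one.
\<close>
definition "t2_diff_image = (\<lambda>v. t2 v - v) ` carrier V"

lemma t2_diff_linear: "linear_on (smult V) (carrier V) (smult V) (\<lambda>v. t2 v - v)"
  using t2_linear by (simp add: linear_on_def deg.scale_right_diff_distrib)

lemma t2_diff_image_submodule: "submodule G V t2_diff_image"
proof (rule submoduleI)
  show "deg.subspace t2_diff_image" unfolding t2_diff_image_def
    by (rule deg.subspace_image[OF t2_diff_linear deg.vector_space_axioms deg.W]) simp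
  show "t2_diff_image \<subseteq> carrier V" by (auto simp: t2_diff_image_def intro: deg.subspace_diff[OF deg.W])
  fix v assume v: "v \<in> t2_diff_image"
  then obtain w where w: "v = t2 w - w" "w \<in> carrier V" by (auto simp: t2_diff_image_def)
  show "hcomp (par V) v i \<in> t2_diff_image" for i
  proof -
    have "hcomp (par V) v i = t2 (hcomp (par V) w i) - hcomp (par V) w i"
      using w deg.linear_on_diff[OF par.hcomp_linear, of "t2 w" w i] by (simp add: hcomp_t2)
    then show ?thesis using par.hcomp_W[OF w(2)] by (auto simp: t2_diff_image_def)
  qed
  show "act V x v \<in> t2_diff_image" if "x \<in> generators A" for x
  proof -
    have x: "x \<in> carrier G" using that by (rule generators_carrier)
    have "act V x v = t2 (act V x w) - act V x w"
      using act_diff[OF x, of "t2 w" w] w by (simp add: t2_commute x)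
    then show ?thesis using act_closed[OF x w(2)] by (auto simp: t2_diff_image_def)
  qed
qed

text \<open>
  No nonzero homogeneous vector \<open>v\<close> has the form \<open>t2 w - w\<close>: comparing components, a nonzero
  component of \<open>w\<close> would force infinitely many further ones, obtained by applying powers of \<open>t2\<close> or of
  its inverse, in the direction that avoids the degree of \<open>v\<close>.
\<close>
lemma t2_diff_image_proper: "t2_diff_image \<noteq> carrier V"
proof
  assume eq: "t2_diff_image = carrier V"
  let ?d = "4 * k + 2"
  have d: "?d \<noteq> 0" by presburger
  obtain v m where v: "v \<in> mdeg V m" "v \<noteq> 0"
  proof -
    obtain v where "v \<in> carrier V" "v \<noteq> 0"
      using simple deg.subspace_0[OF deg.W] by (auto simp: graded_simple_module_def)
    then obtain n where "hcomp (mdeg V) v n \<noteq> 0"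
      using deg.hcomp_sum_keys[of v] by (metis sum.neutral)
    then show thesis using that deg.hcomp_in[OF \<open>v \<in> carrier V\<close>] by blast
  qed
  obtain w where w: "w \<in> carrier V" "v = t2 w - w"
    using eq deg.D_W[OF v(1)] by (auto simp: t2_diff_image_def)
  have step: "t2 (hcomp (mdeg V) w (n - ?d)) = hcomp (mdeg V) w n" if "n \<noteq> m" for n
  proof -
    have "hcomp (mdeg V) v n = t2 (hcomp (mdeg V) w (n - ?d)) - hcomp (mdeg V) w n"
      using w deg.linear_on_diff[OF deg.hcomp_linear, of "t2 w" w n] by (simp add: hcomp_t2)
    then show ?thesis using deg.hcomp_homogeneous[OF v(1), of n] that by simp
  qed
  have "w \<noteq> 0" using v w deg.linear_on_0[OF t2_linear] by auto
  then obtain i where i: "hcomp (mdeg V) w i \<noteq> 0"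
    using deg.hcomp_sum_keys[OF w(1)] by (metis sum.neutral)
  have zw: "t2 (hcomp (mdeg V) w n) = 0 \<longleftrightarrow> hcomp (mdeg V) w n = 0" for n
    using t2_inject[OF deg.hcomp_W[OF w(1)]] deg.linear_on_0[OF t2_linear] by auto
  have "finite {n. hcomp (mdeg V) w n \<noteq> 0}"
    by (simp add: hcomp_def flip: Poly_Mapping.in_keys_iff)
  moreover have "\<exists>e. e \<noteq> 0 \<and> (\<forall>q::nat. hcomp (mdeg V) w (i + int q * e) \<noteq> 0)"
  proof (cases "\<exists>q::nat. i + int (Suc q) * ?d = m")
    case False
    have "hcomp (mdeg V) w (i + int q * ?d) \<noteq> 0" for q
    proof (induction q)
      case (Suc q)
      then show ?case
        using step[of "i + int (Suc q) * ?d"] False zw[of "i + int q * ?d"] by (auto simp: algebra_simps)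
    qed (simp add: i)
    then show ?thesis using d by blast
  next
    case True
    then obtain p :: nat where p: "i + int (Suc p) * ?d = m" by blast
    have "hcomp (mdeg V) w (i + int q * (- ?d)) \<noteq> 0" for q
    proof (induction q)
      case (Suc q)
      have "i + int q * (- ?d) \<noteq> m"
      proof
        assume "i + int q * (- ?d) = m"
        then have "int (Suc p + q) * ?d = 0" using p by (simp add: algebra_simps)
        then show False using d by (simp del: of_nat_add)
      qed
      then show ?case
        using Suc step[of "i + int q * (- ?d)"] zw[of "i + int (Suc q) * (- ?d)"] by (auto simp: algebra_simps)
    qed (simp add: i)
    then show ?thesis using d by (metis neg_equal_0_iff_equal)
  qed
  then obtain e where e: "e \<noteq> 0" "\<And>q::nat. hcomp (mdeg V) w (i + int q * e) \<noteq> 0" by blast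
  have "range (\<lambda>q::nat. i + int q * e) \<subseteq> {n. hcomp (mdeg V) w n \<noteq> 0}" using e by auto
  moreover have "inj (\<lambda>q::nat. i + int q * e)" using e(1) by (auto simp: inj_on_def)
  ultimately show False
    using finite_imageD[of "\<lambda>q::nat. i + int q * e" UNIV] finite_subset by auto
qed

text \<open>
  Modulo the image of \<open>t2 - 1\<close> every homogeneous subspace is identified with the one whose degree
  differs by \<open>4 * k + 2\<close>, so finitely many of them suffice to span.
\<close>
lemma t2_diff_image_cofinite:
  assumes fin: "finite_weight V"
  obtains B where "finite B" "B \<subseteq> carrier V" "\<And>v. v \<in> carrier V \<Longrightarrow> \<exists>n\<in>t2_diff_image. v - n \<in> deg.span B"
proof -
  let ?d = "4 * k + 2"
  have d: "?d \<noteq> 0" by presburger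
  have "\<forall>n. \<exists>B. finite B \<and> B \<subseteq> mdeg V n \<and> deg.span B = mdeg V n"
    using fin by (simp add: finite_weight_def finite_dim_def)
  then obtain b where b: "\<And>n. finite (b n)" "\<And>n. b n \<subseteq> mdeg V n" "\<And>n. deg.span (b n) = mdeg V n"
    by metis
  define B where "B = (\<Union>r\<in>{- \<bar>?d\<bar>..\<bar>?d\<bar>}. b r)"
  have Bfin: "finite B" using b(1) by (simp add: B_def)
  have BV: "B \<subseteq> carrier V" unfolding B_def using b(2) deg.D_W by blast
  let ?T = "{x + y | x y. x \<in> t2_diff_image \<and> y \<in> deg.span B}"
  have T: "deg.subspace ?T"
    by (rule deg.subspace_sums) (auto simp: deg.subspace_span submoduleD[OF t2_diff_image_submodule])
  have Z1T: "t2_diff_image \<subseteq> ?T" using deg.span_zero[of B] by force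
  have base: "mdeg V r \<subseteq> ?T" if "r \<in> {- \<bar>?d\<bar>..\<bar>?d\<bar>}" for r
  proof -
    have "mdeg V r \<subseteq> deg.span B"
      unfolding b(3)[of r, symmetric] using that by (intro deg.span_mono) (auto simp: B_def)
    then show ?thesis using deg.subspace_0[OF submoduleD(1)[OF t2_diff_image_submodule]] by force
  qed
  have z1: "t2 v - v \<in> ?T" if "v \<in> carrier V" for v
    using Z1T that by (auto simp: t2_diff_image_def)
  have up: "mdeg V (m + ?d) \<subseteq> ?T \<longleftrightarrow> mdeg V m \<subseteq> ?T" for m
  proof
    assume H: "mdeg V m \<subseteq> ?T"
    show "mdeg V (m + ?d) \<subseteq> ?T"
    proof
      fix v assume v: "v \<in> mdeg V (m + ?d)"
      then obtain w where w: "w \<in> carrier V" "v = t2 w" using t2_image deg.D_W by blast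
      have "t2 (hcomp (mdeg V) w m) = v"
        using hcomp_t2(2)[OF w(1), of "m + ?d"] deg.hcomp_homogeneous[OF v, of "m + ?d"] w by simp
      moreover have "hcomp (mdeg V) w m \<in> ?T" using H deg.hcomp_in[OF w(1)] by blast
      ultimately show "v \<in> ?T"
        using deg.subspace_add[OF T z1[OF deg.hcomp_W[OF w(1)]], of "hcomp (mdeg V) w m" m] by simp
    qed
  next
    assume H: "mdeg V (m + ?d) \<subseteq> ?T"
    show "mdeg V m \<subseteq> ?T"
    proof
      fix v assume v: "v \<in> mdeg V m"
      have "t2 v \<in> mdeg V (m + ?d)"
        using act_deg[OF basis_vector_homogeneous(1) v, of "T2 k"] by (simp add: t2_def add.commute)
      then have "t2 v \<in> ?T" using H by blast
      then have "t2 v - (t2 v - v) \<in> ?T"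
        by (rule deg.subspace_diff[OF T _ z1[OF deg.D_W[OF v]]])
      then show "v \<in> ?T" by simp
    qed
  qed
  have shift: "mdeg V (m + q * ?d) \<subseteq> ?T \<longleftrightarrow> mdeg V m \<subseteq> ?T" for m q
  proof (induction q rule: int_induct[of _ 0])
    case (step1 q)
    then show ?case using up[of "m + q * ?d"] by (simp add: algebra_simps)
  next
    case (step2 q)
    then show ?case using up[of "m + (q - 1) * ?d"] by (simp add: algebra_simps)
  qed simp
  have all: "mdeg V m \<subseteq> ?T" for m
  proof -
    have "m mod ?d \<in> {- \<bar>?d\<bar>..\<bar>?d\<bar>}" using abs_mod_less[OF d, of m] by auto
    then show ?thesis
      using shift[of "m mod ?d" "m div ?d"] base[of "m mod ?d"] by (simp add: mod_mult_div_eq mult.commute)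
  qed
  have "\<exists>n\<in>t2_diff_image. v - n \<in> deg.span B" if v: "v \<in> carrier V" for v
  proof -
    have "(\<Sum>n\<in>Poly_Mapping.keys (components (mdeg V) v). hcomp (mdeg V) v n) \<in> ?T"
      using all deg.hcomp_in[OF v] by (intro deg.subspace_sum[OF T]) blast
    then have "v \<in> ?T" by (simp only: deg.hcomp_sum_keys[OF v])
    then obtain x y where "v = x + y" "x \<in> t2_diff_image" "y \<in> deg.span B" by auto
    then show ?thesis by (intro bexI[of _ x]) auto
  qed
  then show thesis using that Bfin BV by blast
qed

end

text \<open>
  A maximal proper submodule above one of finite codimension. It is chosen to contain as many
  linearly independent vectors of \<open>span B\<close> as possible.
\<close>
lemma maximal_submodule:
  assumes N0: "submodule G V N0" "N0 \<noteq> carrier V"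
    and B: "finite B" "\<And>v. v \<in> carrier V \<Longrightarrow> \<exists>n\<in>N0. v - n \<in> deg.span B"
  obtains N where "submodule G V N" "N0 \<subseteq> N" "N \<noteq> carrier V"
    "\<And>N'. submodule G V N' \<Longrightarrow> N \<subseteq> N' \<Longrightarrow> N' = N \<or> N' = carrier V"
proof -
  let ?P = "\<lambda>(N, b). submodule G V N \<and> N0 \<subseteq> N \<and> N \<noteq> carrier V \<and> b \<subseteq> N \<inter> deg.span B \<and> deg.independent b"
  have bound: "finite b \<and> card b \<le> card B" if "?P (N, b)" for N b
    using that deg.independent_span_bound[OF B(1), of b] by auto
  have start: "?P (N0, {})" using N0 by (auto simp: deg.independent_empty)
  have le: "\<forall>y. ?P y \<longrightarrow> (card \<circ> snd) y < Suc (card B)" using bound by (auto simp: less_Suc_eq_le)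
  from ex_has_greatest_nat[OF start le]
  obtain y where y1: "?P y" and y2: "\<forall>y'. ?P y' \<longrightarrow> (card \<circ> snd) y' \<le> (card \<circ> snd) y"
    by (elim exE conjE)
  obtain N b where Nb: "y = (N, b)" by (cases y)
  have N: "submodule G V N" "N0 \<subseteq> N" "N \<noteq> carrier V" "b \<subseteq> N" "b \<subseteq> deg.span B" "deg.independent b"
    using y1 Nb by auto
  have "N' = N \<or> N' = carrier V" if N': "submodule G V N'" "N \<subseteq> N'" for N'
  proof (rule ccontr)
    assume neg: "\<not> (N' = N \<or> N' = carrier V)"
    then obtain v where v: "v \<in> N'" "v \<notin> N" using N'(2) by blast
    obtain n where n: "n \<in> N0" "v - n \<in> deg.span B"
      using B(2)[of v] v submoduleD(2)[OF N'(1)] by blast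
    have 1: "v - n \<in> N'"
      using v n N(2) N'(2) by (intro deg.subspace_diff submoduleD(1)[OF N'(1)]) auto
    have 2: "v - n \<notin> N"
      using deg.subspace_add[OF submoduleD(1)[OF N(1)], of "v - n" n] v n N(2) by auto
    have "deg.span b \<subseteq> N" using N by (intro deg.span_minimal submoduleD(1)[OF N(1)]) auto
    then have 3: "v - n \<notin> deg.span b" using 2 by auto
    then have "deg.independent (insert (v - n) b)" using N by (intro deg.independent_insertI) auto
    then have "?P (N', insert (v - n) b)" using N N' n(2) 1 neg by auto
    then have "card (insert (v - n) b) \<le> card b" using y2[rule_format, of "(N', insert (v - n) b)"] Nb by simp
    moreover have "card (insert (v - n) b) = Suc (card b)"
    proof (rule card_insert_disjoint)
      show "finite b" using bound[of N b] y1 Nb by blast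
      show "v - n \<notin> b" using 3 deg.span_base by blast
    qed
    ultimately show False by simp
  qed
  then show thesis using that N by blast
qed

end

section \<open>Embedding into a loop module\<close>

lemma lookup_map_qscale [simp]:
  "Poly_Mapping.lookup (Poly_Mapping.map (qscale c) p) n = qscale c (Poly_Mapping.lookup p n)"
  by (simp add: map.rep_eq when_def)

lemma vector_space_map_qscale: "vector_space (\<lambda>c. Poly_Mapping.map (qscale c))"
proof -
  interpret vector_space qscale by (rule vector_space_qscale)
  show ?thesis
    by unfold_locales (rule poly_mapping_eqI, simp add: lookup_add scale_right_distrib scale_left_distrib)+
qed

context quadratic_module
begin

text \<open>
  The module \<open>U\<close> is the quotient of \<open>V\<close> by a maximal submodule \<open>N\<close> above the image of \<open>t2 - 1\<close>, with \<open>\<phi>\<close>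
  as the projection. The map \<open>F\<close> sends a vector \<open>v\<close> of degree \<open>n\<close> to \<open>\<phi> v \<otimes> t\<^sup>n\<close>; its kernel consists of
  the vectors with all components in \<open>N\<close>, so it is a proper graded submodule, hence zero.
\<close>
theorem loop_embedding:
  assumes simple: "graded_simple_module G V" and fin: "finite_weight V"
    and nontrivial: "\<exists>v\<in>carrier V. act V (basis_vector (T2 k)) v \<noteq> 0"
  shows "\<exists>(U :: ('a \<times> quad, nat \<Rightarrow>\<^sub>0 complex) gmodule) X f.
    simple_module G U \<and> finite_dim (smult U) (carrier U) \<and>
    simple_component G (loop_module G U) X \<and>
    graded_module_iso G V (mod_restrict (loop_module G U) X) f"
proof -
  obtain B where B: "finite B" "B \<subseteq> carrier V" "\<And>v. v \<in> carrier V \<Longrightarrow> \<exists>n\<in>t2_diff_image k. v - n \<in> deg.span B"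
    using t2_diff_image_cofinite[OF simple nontrivial fin] by blast
  obtain N where N: "submodule G V N" "t2_diff_image k \<subseteq> N" "N \<noteq> carrier V"
    and N_max: "\<And>N'. submodule G V N' \<Longrightarrow> N \<subseteq> N' \<Longrightarrow> N' = N \<or> N' = carrier V"
    using maximal_submodule[OF t2_diff_image_submodule[OF simple nontrivial] t2_diff_image_proper[OF simple nontrivial] B(1,3)] by metis
  note N_sub = submoduleD[OF N(1)]
  obtain \<phi> :: "'v \<Rightarrow> nat \<Rightarrow>\<^sub>0 complex"
    where \<phi>: "linear_on (smult V) (carrier V) qscale \<phi>"
    and \<phi>_ker: "\<And>v. v \<in> carrier V \<Longrightarrow> \<phi> v = 0 \<longleftrightarrow> v \<in> N" and \<phi>_fin: "finite_dim qscale (\<phi> ` carrier V)"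
    using deg.finite_quotient[OF N_sub(1,2) B(1,2)] B(3) N(2) by (smt (verit) subsetD)
  have \<phi>_eq: "\<phi> v = \<phi> w \<longleftrightarrow> v - w \<in> N" if "v \<in> carrier V" "w \<in> carrier V" for v w
    using that \<phi>_ker[of "v - w"] deg.linear_on_diff[OF \<phi> that] deg.subspace_diff[OF deg.W that] by auto
  \<comment> \<open>The action on \<open>U\<close> is computed on an arbitrary preimage under \<open>\<phi>\<close>.\<close>
  define U :: "('a \<times> quad, nat \<Rightarrow>\<^sub>0 complex) gmodule" where
    "U = \<lparr>carrier = \<phi> ` carrier V, smult = qscale, par = (\<lambda>i. \<phi> ` par V i),
      act = (\<lambda>x u. \<phi> (act V x (inv_into (carrier V) \<phi> u)))\<rparr>"
  have U [simp]: "carrier U = \<phi> ` carrier V" "par U i = \<phi> ` par V i" "smult U = qscale" for i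
    by (simp_all add: U_def)
  have U_act: "act U x (\<phi> v) = \<phi> (act V x v)" if x: "x \<in> carrier G" and v: "v \<in> carrier V" for x v
  proof -
    let ?w = "inv_into (carrier V) \<phi> (\<phi> v)"
    have w: "?w \<in> carrier V" "\<phi> ?w = \<phi> v"
      using v by (auto intro: inv_into_into f_inv_into_f)
    then have "act V x (?w - v) \<in> N" using \<phi>_eq[OF w(1) v] x by (intro N_sub(4)) auto
    then show ?thesis
      using \<phi>_eq[OF act_closed[OF x w(1)] act_closed[OF x v]] act_diff[OF x w(1) v] by (simp add: U_def)
  qed
  have \<phi>_kerp: "\<phi> (hcomp (par V) v i) = 0" if "v \<in> carrier V" "\<phi> v = 0" for v i
    using that \<phi>_ker N_sub(3) par.hcomp_W by simp
  have vsU: "vector_space (smult U)" by (simp add: vector_space_qscale)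
  have linU: "linear_on (smult V) (carrier V) (smult U) \<phi>" by (simp add: \<phi>)
  have "super_module G U"
    by (rule super_module_image[OF U(1,2) vsU linU \<phi>_kerp U_act])
  moreover have "carrier U \<noteq> {0}"
  proof
    assume "carrier U = {0}"
    then have "carrier V \<subseteq> N" using \<phi>_ker by auto
    then show False using N(3) N_sub(2) by auto
  qed
  moreover have "X = {0} \<or> X = carrier U" if X: "submodule G U X" for X
  proof -
    let ?Y = "{v \<in> carrier V. \<phi> v \<in> X}"
    have Y: "submodule G V ?Y"
      by (rule submodule_vimage[OF U(1,2) vsU linU \<phi>_kerp U_act X])
    interpret t: vector_space "smult U" by (rule vsU)
    have X0: "0 \<in> X" "X \<subseteq> carrier U" using X t.subspace_0 by (auto simp: submodule_def)
    have "N \<subseteq> ?Y"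
    proof
      fix v assume v: "v \<in> N"
      then have "v \<in> carrier V" using N_sub(2) by blast
      then show "v \<in> ?Y" using \<phi>_ker[of v] v X0(1) by simp
    qed
    then have "?Y = N \<or> ?Y = carrier V" by (rule N_max[OF Y])
    moreover have "X = \<phi> ` ?Y" using X0 by auto
    moreover have "\<phi> ` N = {0}" using \<phi>_ker N_sub(2) deg.subspace_0[OF N_sub(1)] by force
    ultimately show ?thesis by auto
  qed
  ultimately have U_simple: "simple_module G U" by (simp add: simple_module_def)

  define L where "L = loop_module G U"
  have L: "carrier L = {f. \<forall>n. Poly_Mapping.lookup f n \<in> \<phi> ` carrier V}"
    "smult L = (\<lambda>c. Poly_Mapping.map (qscale c))"
    "par L i = {f. \<forall>n. Poly_Mapping.lookup f n \<in> \<phi> ` par V i}"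
    "mdeg L n = Poly_Mapping.single n ` \<phi> ` carrier V" for i n
    by (simp_all add: L_def loop_module_def)
  define F where "F v = Poly_Mapping.map \<phi> (components (mdeg V) v)" for v
  have \<phi>_0: "\<phi> 0 = 0" by (rule deg.linear_on_0[OF \<phi>])
  have F: "Poly_Mapping.lookup (F v) n = \<phi> (hcomp (mdeg V) v n)" for v n
    by (simp add: F_def map.rep_eq when_def hcomp_def \<phi>_0)
  have F_lin: "linear_on (smult V) (carrier V) (smult L) F"
    unfolding linear_on_def
    by (auto intro!: poly_mapping_eqI simp: F L lookup_add deg.hcomp_add deg.hcomp_scale deg.hcomp_W
      linear_on_add[OF \<phi>] linear_on_scale[OF \<phi>])
  have F_0: "F v = 0 \<longleftrightarrow> (\<forall>n. hcomp (mdeg V) v n \<in> N)" if v: "v \<in> carrier V" for v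
    using \<phi>_ker[OF deg.hcomp_W[OF v]] by (metis F lookup_zero poly_mapping_eqI)
  have vsL: "vector_space (smult L)" by (simp add: L vector_space_map_qscale)
  have F_inj: "v = 0" if v: "v \<in> carrier V" "F v = 0" for v
  proof -
    let ?K = "{v \<in> carrier V. F v \<in> {0}}"
    interpret l: vector_space "smult L" by (rule vsL)
    have "graded_submodule G V ?K"
    proof (rule graded_submoduleI)
      show "deg.subspace ?K"
        by (rule deg.subspace_vimage[OF F_lin vsL]) (rule l.subspace_single_0)
      fix v assume "v \<in> ?K"
      then have v: "v \<in> carrier V" "\<And>n. hcomp (mdeg V) v n \<in> N" using F_0 by auto
      show "hcomp (par V) v i \<in> ?K" for i
        using v by (simp add: F_0 par.hcomp_W hcomp_commute N_sub(3))
      show "hcomp (mdeg V) v m \<in> ?K" for m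
        using v deg.subspace_0[OF N_sub(1)]
        by (simp add: F_0 deg.hcomp_W deg.hcomp_homogeneous[OF deg.hcomp_in])
      fix x assume "x \<in> generators A"
      then obtain m where x: "x \<in> ldeg G m" "x \<in> carrier G"
        using generators_homogeneous generators_carrier by metis
      show "act V x v \<in> ?K"
        using v x by (simp add: F_0 act_closed hcomp_act_deg N_sub(4))
    qed auto
    then have "?K = {0} \<or> ?K = carrier V" using simple by (auto simp: graded_simple_module_def)
    moreover have "?K \<noteq> carrier V"
    proof
      assume K: "?K = carrier V"
      have "v \<in> N" if v: "v \<in> carrier V" for v
      proof -
        have "hcomp (mdeg V) v n \<in> N" for n using K F_0[OF v] v by auto
        then have "(\<Sum>n\<in>Poly_Mapping.keys (components (mdeg V) v). hcomp (mdeg V) v n) \<in> N"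
          by (intro deg.subspace_sum N_sub(1))
        then show ?thesis by (simp only: deg.hcomp_sum_keys[OF v])
      qed
      then show False using N(3) N_sub(2) by auto
    qed
    ultimately have "?K = {0}" by blast
    then show ?thesis using v by blast
  qed
  have U_act_0: "act U x 0 = 0" if "x \<in> carrier G" for x
    using U_act[OF that, of 0] deg.subspace_0[OF deg.W] that by (simp add: \<phi>_0)
  have F_act: "act L x (F v) = F (act V x v)" if x: "x \<in> carrier G" and v: "v \<in> carrier V" for x v
  proof (rule poly_mapping_eqI)
    fix j
    let ?d = "components (ldeg G) x"
    have xm: "Poly_Mapping.lookup ?d m \<in> ldeg G m" for m
      using G.hcomp_in[OF x, of m] by (simp add: hcomp_def)
    have "Poly_Mapping.lookup (act L x (F v)) j =
      (\<Sum>m\<in>Poly_Mapping.keys ?d. \<Sum>n\<in>Poly_Mapping.keys (F v).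
        if n = j - m then act U (Poly_Mapping.lookup ?d m) (\<phi> (hcomp (mdeg V) v n)) else 0)"
      by (simp add: L_def loop_module_def Let_def lookup_sum lookup_single when_def F eq_diff_eq
          del: sum.delta sum.delta')
    also have "\<dots> = (\<Sum>m\<in>Poly_Mapping.keys ?d. act U (Poly_Mapping.lookup ?d m) (\<phi> (hcomp (mdeg V) v (j - m))))"
    proof (rule sum.cong)
      fix m
      show "(\<Sum>n\<in>Poly_Mapping.keys (F v).
          if n = j - m then act U (Poly_Mapping.lookup ?d m) (\<phi> (hcomp (mdeg V) v n)) else 0)
        = act U (Poly_Mapping.lookup ?d m) (\<phi> (hcomp (mdeg V) v (j - m)))"
        using U_act_0[OF G.D_W[OF xm]] by (auto simp: in_keys_iff F)
    qed simp
    also have "\<dots> = (\<Sum>m\<in>Poly_Mapping.keys ?d. \<phi> (hcomp (mdeg V) (act V (Poly_Mapping.lookup ?d m) v) j))"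
      by (simp add: U_act[OF G.D_W[OF xm]] deg.hcomp_W v hcomp_act_deg[OF xm])
    also have "\<dots> = \<phi> (\<Sum>m\<in>Poly_Mapping.keys ?d. hcomp (mdeg V) (act V (Poly_Mapping.lookup ?d m) v) j)"
      by (rule deg.linear_on_sum[OF \<phi>, symmetric]) (auto intro!: deg.hcomp_W act_closed v G.D_W[OF xm])
    also have "(\<Sum>m\<in>Poly_Mapping.keys ?d. hcomp (mdeg V) (act V (Poly_Mapping.lookup ?d m) v) j)
      = hcomp (mdeg V) (\<Sum>m\<in>Poly_Mapping.keys ?d. act V (Poly_Mapping.lookup ?d m) v) j"
      by (rule deg.linear_on_sum[OF deg.hcomp_linear, symmetric]) (auto intro!: act_closed v G.D_W[OF xm])
    also have "(\<Sum>m\<in>Poly_Mapping.keys ?d. act V (Poly_Mapping.lookup ?d m) v) = act V x v"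
    proof -
      have "act V (\<Sum>m\<in>Poly_Mapping.keys ?d. Poly_Mapping.lookup ?d m) v
        = (\<Sum>m\<in>Poly_Mapping.keys ?d. act V (Poly_Mapping.lookup ?d m) v)"
        by (rule act_sum_left) (auto intro!: v G.D_W[OF xm])
      then show ?thesis using G.hcomp_sum_keys[OF x] by (simp add: hcomp_def)
    qed
    finally show "Poly_Mapping.lookup (act L x (F v)) j = Poly_Mapping.lookup (F (act V x v)) j"
      by (simp add: F)
  qed
  define X where "X = F ` carrier V"
  have X_par: "par L i \<inter> X = F ` par V i" for i
  proof
    show "F ` par V i \<subseteq> par L i \<inter> X"
      using par.D_W mdeg_hcomp_par by (auto simp: X_def L F)
    show "par L i \<inter> X \<subseteq> F ` par V i"
    proof
      fix f assume "f \<in> par L i \<inter> X"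
      then obtain v where v: "v \<in> carrier V" "f = F v" and Fv: "\<And>n. \<phi> (hcomp (mdeg V) v n) \<in> \<phi> ` par V i"
        by (auto simp: X_def L F)
      have "F (v - hcomp (par V) v i) = 0"
      proof -
        have "\<phi> (hcomp (mdeg V) v n) = \<phi> (hcomp (mdeg V) (hcomp (par V) v i) n)" for n
        proof -
          let ?v = "hcomp (mdeg V) v n"
          obtain w where w: "w \<in> par V i" "\<phi> ?v = \<phi> w" using Fv[of n] by blast
          have vV: "?v \<in> carrier V" using v by (simp add: deg.hcomp_W)
          have "?v - w \<in> N" using \<phi>_eq[OF vV par.D_W[OF w(1)]] w(2) by simp
          then have "hcomp (par V) (?v - w) i \<in> N" by (rule N_sub(3))
          then have "hcomp (par V) ?v i - w \<in> N"
            using deg.linear_on_diff[OF par.hcomp_linear vV par.D_W[OF w(1)], of i] w(1)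
            by (simp add: par.hcomp_homogeneous)
          then show ?thesis
            using \<phi>_eq[OF par.hcomp_W[OF vV, of i] par.D_W[OF w(1)]] w(2) by (simp add: hcomp_commute[OF v(1)])
        qed
        then have "F v = F (hcomp (par V) v i)" by (intro poly_mapping_eqI) (simp add: F)
        then show ?thesis using deg.linear_on_diff[OF F_lin v(1) par.hcomp_W[OF v(1)]] by simp
      qed
      then have "v = hcomp (par V) v i"
        using F_inj[of "v - hcomp (par V) v i"] deg.subspace_diff[OF deg.W v(1) par.hcomp_W[OF v(1)]] by auto
      then show "f \<in> F ` par V i" using v par.hcomp_in[OF v(1), of i] by auto
    qed
  qed
  have X_deg: "mdeg L n \<inter> X = F ` mdeg V n" for n
  proof
    show "F ` mdeg V n \<subseteq> mdeg L n \<inter> X"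
    proof
      fix f assume "f \<in> F ` mdeg V n"
      then obtain v where v: "v \<in> mdeg V n" "f = F v" by blast
      have "f = Poly_Mapping.single n (\<phi> v)"
        by (rule poly_mapping_eqI)
          (simp add: v(2) F deg.hcomp_homogeneous[OF v(1)] lookup_single when_def \<phi>_0)
      then have "f \<in> mdeg L n" using deg.D_W[OF v(1)] unfolding L by blast
      moreover have "f \<in> X" using deg.D_W[OF v(1)] unfolding X_def v(2) by (rule imageI)
      ultimately show "f \<in> mdeg L n \<inter> X" by blast
    qed
    show "mdeg L n \<inter> X \<subseteq> F ` mdeg V n"
    proof
      fix f assume f: "f \<in> mdeg L n \<inter> X"
      then obtain v where v: "v \<in> carrier V" "f = F v" unfolding X_def by blast
      from f obtain u where "f = Poly_Mapping.single n u" unfolding L by blast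
      then have u: "F v = Poly_Mapping.single n u" using v(2) by simp
      have "F (v - hcomp (mdeg V) v n) = 0"
      proof -
        have "\<phi> (hcomp (mdeg V) v m) = 0" if "m \<noteq> n" for m
          using arg_cong[OF u, of "\<lambda>p. Poly_Mapping.lookup p m"] that by (simp add: F lookup_single)
        then have "F v = F (hcomp (mdeg V) v n)"
          by (intro poly_mapping_eqI)
            (simp add: F deg.hcomp_homogeneous[OF deg.hcomp_in[OF v(1)]] \<phi>_0)
        then show ?thesis using deg.linear_on_diff[OF F_lin v(1) deg.hcomp_W[OF v(1)]] by simp
      qed
      then have "v = hcomp (mdeg V) v n"
        using F_inj[of "v - hcomp (mdeg V) v n"] deg.subspace_diff[OF deg.W v(1) deg.hcomp_W[OF v(1)]] by auto
      then show "f \<in> F ` mdeg V n" using v deg.hcomp_in[OF v(1), of n] by auto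
    qed
  qed
  have F_ker: "F (hcomp D v i) = 0" if "v \<in> carrier V" "F v = 0" "hcomp D 0 i = 0" for D :: "'i \<Rightarrow> 'v set" and v i
    using F_inj[OF that(1,2)] deg.linear_on_0[OF F_lin] that(3) by simp
  have M: "carrier (mod_restrict L X) = F ` carrier V" "par (mod_restrict L X) i = F ` par V i"
    "mdeg (mod_restrict L X) n = F ` mdeg V n" "smult (mod_restrict L X) = smult L"
    "act (mod_restrict L X) = act L" for i n
    using X_par X_deg by (simp_all add: mod_restrict_def X_def)
  have M_simple: "graded_simple_module G (mod_restrict L X)"
    by (rule graded_simple_image[OF simple, where f = F]) (simp_all add: M vsL F_lin F_inj F_act)
  have "graded_submodule G L X"
    unfolding graded_submodule_def submodule_def
  proof (intro conjI ballI)
    show "module.subspace (smult L) X"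
      unfolding X_def by (rule deg.subspace_image[OF F_lin vsL deg.W]) simp
    show "X \<subseteq> carrier L" by (auto simp: X_def L F deg.hcomp_W)
    show "internal_direct_sum (smult L) X (\<lambda>i. par L i \<inter> X)"
      unfolding X_par unfolding X_def
      by (rule par.direct_image[OF F_lin vsL]) (simp add: F_ker)
    show "internal_direct_sum (smult L) X (\<lambda>n. mdeg L n \<inter> X)"
      unfolding X_deg unfolding X_def
      by (rule deg.direct_image[OF F_lin vsL]) (simp add: F_ker)
    show "act L x f \<in> X" if "x \<in> carrier G" "f \<in> X" for x f
      using that by (auto simp: X_def F_act act_closed)
  qed
  then have "simple_component G L X" using M_simple by (simp add: simple_component_def)
  moreover have "graded_module_iso G V (mod_restrict L X) F"
    unfolding graded_module_iso_def M
  proof (intro conjI allI ballI)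
    show "bij_betw F (carrier V) (F ` carrier V)"
      by (intro bij_betw_imageI inj_onI)
        (metis deg.linear_on_diff[OF F_lin] F_inj deg.subspace_diff[OF deg.W] right_minus_eq, simp)
  qed (simp_all add: F_lin F_act)
  moreover have "finite_dim (smult U) (carrier U)" using \<phi>_fin by simp
  ultimately show ?thesis using U_simple unfolding L_def by blast
qed

end

section \<open>Restriction to \<open>A \<oplus> s\<^sup>2\<complex>[s\<^sup>\<plusminus>\<^sup>4]\<close>\<close>

text \<open>
  The function \<open>dim\<close> is total, so finite-dimensionality has to be assumed separately.
\<close>
lemma (in vector_subspace) card_le_dim:
  assumes fin: "finite_dim s W" and X: "X \<subseteq> W" "independent X"
  shows "card X \<le> dim W"
proof -
  obtain B where B: "finite B" "B \<subseteq> W" "span B = W" using fin by (auto simp: finite_dim_def)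
  obtain C where C: "C \<subseteq> W" "independent C" "W \<subseteq> span C" "card C = dim W"
    using basis_exists[of W] by blast
  have "finite C" using independent_span_bound[OF B(1) C(2)] C(1) B(3) by auto
  then show ?thesis using independent_span_bound[of C X] X C by auto
qed

context abelian_plus_quadratic
begin

lemma lie_restrict_simps:
  "carrier (lie_restrict G H) = H" "smult (lie_restrict G H) = smult G"
  "par (lie_restrict G H) i = par G i \<inter> H" "bracket (lie_restrict G H) = bracket G"
  "ldeg (lie_restrict G H) n = ldeg G n \<inter> H"
  by (simp_all add: lie_restrict_def)

lemma restricted_abelian:
  "graded_abelian_lie_algebra (lie_restrict G (carrier A \<times> S2_space))" (is "graded_abelian_lie_algebra ?R")
proof -
  let ?H = "carrier A \<times> S2_space"
  have dir: "internal_direct_sum (smult G) ?H (\<lambda>n. ldeg G n \<inter> ?H)"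
  proof -
    have "ldeg G n \<inter> ?H = ldeg A n \<times> qspan {b \<in> range S2. qdeg b = n}" for n
      using A.D_W by (auto simp: G_def qspan_def)
    then show ?thesis
      using direct_prod[OF vector_space_A vector_space_qscale A_direct direct_qspan[of "range S2" qdeg]]
      by (simp add: G_def)
  qed
  interpret h: graded_space "smult G" ?H "\<lambda>n. ldeg G n \<inter> ?H"
    using dir vector_space_G by (simp add: graded_space_def graded_space_axioms_def)
  have par: "par G 0 \<inter> ?H = ?H" "par G 1 \<inter> ?H = {0}"
  proof -
    show "par G 0 \<inter> ?H = ?H" by (auto simp: G_def A_par_0 qspan_def)
    have "q = 0" if "q \<in> qspan {b. qpar b = 1}" "q \<in> S2_space" for q :: quad
      by (rule poly_mapping_eqI) (use that in \<open>auto simp: qspan_iff\<close>, metis qpar.simps(1) rangeE zero_neq_one)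
    then show "par G 1 \<inter> ?H = {0}"
      using G.subspace_0[OF h.W] by (auto simp: G_def A_par_1 zero_prod_def qspan_def)
  qed
  have even: "internal_direct_sum (smult G) X (\<lambda>i. X \<inter> (par G i \<inter> ?H))"
    if "G.subspace X" "X \<subseteq> ?H" for X
    by (rule direct_even[OF vector_space_G that(1)]) (use that par G.subspace_0[OF that(1)] in auto)
  have super: "superspace ?R"
    unfolding superspace_def lie_restrict_simps
  proof
    have "(\<lambda>i. ?H \<inter> (par G i \<inter> ?H)) = (\<lambda>i. par G i \<inter> ?H)" by auto
    then show "internal_direct_sum (smult G) ?H (\<lambda>i. par G i \<inter> ?H)" using even[OF h.W] by simp
  qed (rule vector_space_G)
  have br [simp]: "bracket G x y = 0" if "x \<in> ?H" "y \<in> ?H" for x y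
    using that by (auto simp: G_def qbracket_S2 zero_prod_def)
  have zero [simp]: "0 \<in> ?H" by (rule G.subspace_0[OF h.W])
  have lie: "lie_superalgebra ?R"
    unfolding lie_superalgebra_def lie_restrict_simps
  proof (intro conjI allI ballI)
    show "bilinear_on (smult G) ?H (smult G) ?H (smult G) (bracket G)"
      using G.subspace_add[OF h.W] G.subspace_scale[OF h.W]
      by (simp add: bilinear_on_def linear_on_def del: mem_Sigma_iff)
  next
    fix i j x y assume "x \<in> par G i \<inter> ?H" "y \<in> par G j \<inter> ?H"
    moreover have "0 \<in> par G i" for i
      using par(1,2) zero bit_cases[of i] by (metis IntD1 singletonI)
    ultimately show "bracket G x y \<in> par G (i + j) \<inter> ?H" "bracket G x y = - smult G (ksign i j) (bracket G y x)"
      by (simp_all del: mem_Sigma_iff)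
  next
    fix i j x y v assume "x \<in> par G i \<inter> ?H" "y \<in> par G j \<inter> ?H" "v \<in> ?H"
    then show "bracket G x (bracket G y v)
        = bracket G (bracket G x y) v + smult G (ksign i j) (bracket G y (bracket G x v))"
      by (simp del: mem_Sigma_iff)
  qed (rule super)
  have "graded_superspace ?R (ldeg ?R)"
    unfolding graded_superspace_def lie_restrict_simps
  proof (intro conjI allI)
    show "internal_direct_sum (smult G) (ldeg G n \<inter> ?H) (\<lambda>i. ldeg G n \<inter> ?H \<inter> (par G i \<inter> ?H))" for n
      by (rule even[OF h.D(1)]) auto
  qed (use super dir in simp_all)
  moreover have "bracket G x y \<in> ldeg G (k + l) \<inter> ?H" if "x \<in> ldeg G k \<inter> ?H" "y \<in> ldeg G l \<inter> ?H" for k l x y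
    using that G.subspace_0[OF h.D(1)] by (simp del: mem_Sigma_iff)
  ultimately have "graded_lie_superalgebra ?R"
    using lie by (simp add: graded_lie_superalgebra_def lie_restrict_simps del: mem_Sigma_iff)
  then show ?thesis
    using par by (simp add: graded_abelian_lie_algebra_def lie_restrict_simps del: mem_Sigma_iff)
qed

end

context T2_trivial_module
begin

text \<open>
  When the odd part and \<open>t\<^sup>2\<complex>[t\<^sup>\<plusminus>\<^sup>4]\<close> act as zero, the graded submodules over the subalgebra
  \<open>A \<oplus> s\<^sup>2\<complex>[s\<^sup>\<plusminus>\<^sup>4]\<close> are those over \<open>G\<close>.
\<close>
lemma restricted_simple:
  assumes simple: "graded_simple_module G V"
    and odd: "\<And>b v. qpar b = 1 \<Longrightarrow> v \<in> carrier V \<Longrightarrow> act V (basis_vector b) v = 0"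
  shows "graded_simple_module (lie_restrict G (carrier A \<times> S2_space)) V"
proof -
  let ?H = "carrier A \<times> S2_space"
  let ?R = "lie_restrict G ?H"
  have H: "x \<in> carrier G" if "x \<in> ?H" for x using that by (auto simp: G_def)
  have "graded_module ?R V"
    unfolding graded_module_def super_module_def bilinear_on_def lie_restrict_simps
  proof (intro conjI allI ballI)
    show "linear_on (smult V) (carrier V) (smult V) (act V x)" if "x \<in> ?H" for x
      by (rule act_linear[OF H[OF that]])
    show "linear_on (smult G) ?H (smult V) (\<lambda>x. act V x v)" if "v \<in> carrier V" for v
      using act_linear_left[OF that] H unfolding linear_on_def by blast
  qed (use V act_par act_bracket act_deg in \<open>auto simp: graded_module_def graded_superspace_def\<close>)
  moreover have "X = {0} \<or> X = carrier V" if X: "graded_submodule ?R V X" for X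
  proof -
    have X': "deg.subspace X" "X \<subseteq> carrier V" "\<And>x v. x \<in> ?H \<Longrightarrow> v \<in> X \<Longrightarrow> act V x v \<in> X"
      using X by (auto simp: graded_submodule_def submodule_def lie_restrict_simps)
    have gen: "act V x v \<in> X" if x: "x \<in> generators A" and v: "v \<in> X" for x v
    proof -
      have vV: "v \<in> carrier V" using v X'(2) by blast
      show ?thesis
        using x
      proof (cases rule: generators_cases)
        case (abelian a) then show ?thesis using X'(3)[OF _ v] by (simp add: qspan_def)
      next
        case (s k) then show ?thesis using X'(3)[OF _ v] by (simp add: basis_vector_def qspan_def)
      next
        case t2 then show ?thesis using T2_act_0[OF vV] deg.subspace_0[OF X'(1)] by simp
      next
        case odd then show ?thesis using assms(2)[OF _ vV] deg.subspace_0[OF X'(1)] by simp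
      qed
    qed
    have "act V x v \<in> X" if "x \<in> carrier G" "v \<in> X" for x v
      using subspace_act_induct[OF X'(1) subsetD[OF X'(2) that(2)] gen[OF _ that(2)] that(1)] .
    then have "graded_submodule G V X"
      using X by (auto simp: graded_submodule_def submodule_def)
    then show ?thesis using simple by (simp add: graded_simple_module_def)
  qed
  ultimately show ?thesis using simple by (simp add: graded_simple_module_def)
qed

end

section \<open>Bounded graded simple modules\<close>

theorem theorem3p10:
  fixes A :: "'a::ab_group_add graded_lie"
    and \<gg> :: "('a \<times> quad) graded_lie"
    and V :: "('a \<times> quad, 'v::ab_group_add) graded_gmodule"
  assumes "graded_abelian_lie_algebra A"
    and "\<gg> = lie_sum A quadratic"
    and "graded_simple_module \<gg> V"
    and "bounded_finite_weight V"
  shows "(\<not> acts_trivially ({0} \<times> T2_space) V \<and>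
          (\<exists>(U :: ('a \<times> quad, nat \<Rightarrow>\<^sub>0 complex) gmodule) W f.
             simple_module \<gg> U \<and> finite_dim (smult U) (carrier U) \<and>
             simple_component \<gg> (loop_module \<gg> U) W \<and>
             graded_module_iso \<gg> V (mod_restrict (loop_module \<gg> U) W) f))
       \<or> (acts_trivially ({0} \<times> T2_space) V \<and>
          acts_trivially ({0} \<times> {x + y + z | x y z. x \<in> T2_space \<and> y \<in> Tp_space \<and> z \<in> Tm_space}) V \<and>
          graded_abelian_lie_algebra (lie_restrict \<gg> (carrier A \<times> S2_space)) \<and>
          graded_simple_module (lie_restrict \<gg> (carrier A \<times> S2_space)) V \<and>
          finite_weight V)"
proof -
  interpret quadratic_module A "lie_sum A quadratic" V
    using assms by unfold_locales (simp_all add: graded_simple_module_def)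
  have simple: "graded_simple_module (lie_sum A quadratic) V" using assms by simp
  have fin: "finite_weight V" using assms by (simp add: bounded_finite_weight_def)
  show ?thesis
  proof (cases "acts_trivially ({0} \<times> T2_space) V")
    case False
    then obtain q v where q: "q \<in> T2_space" "v \<in> carrier V" "act V (0, q) v \<noteq> 0"
      by (auto simp: acts_trivially_def)
    then obtain b where "b \<in> Poly_Mapping.keys q" "act V (basis_vector b) v \<noteq> 0"
      using quad_act_0 by blast
    moreover from this obtain k where "b = T2 k" using q(1) by (auto simp: qspan_def)
    ultimately have "\<exists>v\<in>carrier V. act V (basis_vector (T2 k)) v \<noteq> 0" using q(2) by blast
    from loop_embedding[OF simple fin this] show ?thesis using False assms(2) by simp
  next
    case True
    then interpret T2_trivial_module A "lie_sum A quadratic" V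
      by unfold_locales (auto simp: acts_trivially_def)
    obtain N where N: "\<And>n. deg.dim (mdeg V n) \<le> N"
      using assms(4) by (auto simp: bounded_finite_weight_def)
    have card: "card X \<le> N" if "X \<subseteq> mdeg V n" "deg.independent X" for n X
    proof -
      interpret m: vector_subspace "smult V" "mdeg V n" by unfold_locales (rule deg.D)
      have "card X \<le> deg.dim (mdeg V n)"
        using fin that by (intro m.card_le_dim) (simp_all add: finite_weight_def)
      then show ?thesis using N[of n] by simp
    qed
    have odd: "act V (basis_vector b) v = 0" if "qpar b = 1" "v \<in> carrier V" for b v
      by (rule odd_acts_trivially[OF simple card that])
    have "act V (0, x + y + z) v = 0"
      if "x \<in> T2_space" "y \<in> Tp_space" "z \<in> Tm_space" "v \<in> carrier V" for x y z v
    proof (rule quad_act_0[OF _ that(4)])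
      fix b assume "b \<in> Poly_Mapping.keys (x + y + z)"
      then have "b \<in> range T2 \<union> range Tp \<union> range Tm"
        using that(1-3) Poly_Mapping.keys_add[of "x + y" z] Poly_Mapping.keys_add[of x y]
        unfolding qspan_def by blast
      then show "act V (basis_vector b) v = 0" using T2_act_0 odd that(4) by auto
    qed
    then have "acts_trivially ({0} \<times> {x + y + z | x y z. x \<in> T2_space \<and> y \<in> Tp_space \<and> z \<in> Tm_space}) V"
      by (auto simp: acts_trivially_def)
    then show ?thesis
      using True restricted_abelian restricted_simple[OF simple odd] fin assms(2) by simp
  qed
qed

end
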